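(* Let $\mathcal{G}$ be a finite metric graph with two non-adjacent vertices $x,y$. Let $\mathcal{G}'$ be the graph obtained from $\mathcal{G}$ by attaching an edge $e$ of length $l_0$ between the vertices $x,y$. Then the volume entropy $h=h_{\mathcal{G}'}$ of $\mathcal{G}'$ satisfies $$e^{l_0h}=\sqrt{f_{xx}(h)f_{yy}(h)}+f_{xy}(h),$$ where $f_{xx}, f_{yy}, f_{xy}$ are the generating functions of $\mathcal{G}$ from $x$ to $x$, from $y$ to $y$, and from $x$ to $y$, respectively.
   Context: A finite metric graph $\mathcal{G}$ has a finite vertex set $V\mathcal{G}$ and a finite set $E\mathcal{G}$ of oriented edges; each oriented edge $e$ has a reverse edge $\overline{e}$, and $e,\overline e$ have the same positive length. Attaching an edge $e=[x,y]$ means that $V\mathcal{G}'=V\mathcal{G}$ and $E\mathcal{G}'=E\mathcal{G}\cup\{e,\overline e\}$. A path is a concatenation of (at least one) adjacent edges with consistent orientation, starting and ending at vertices; its length $l(\mathbf p)$ is the sum of the lengths of its edges. A path is without backtracking if no edge $e$ in it is immediately followed by $\overline{e}$. For vertices $z,w$ of $\mathcal{G}$, $\mathcal{P}_{zw}$ is the set of paths without backtracking in $\mathcal G$ from $z$ to $w$, and the generating function of $\mathcal{G}$ from $z$ to $w$ is $f_{zw}(t)=\sum_{\mathbf p\in\mathcal{P}_{zw}}e^{-l(\mathbf p)t}$. The volume entropy of a finite metric graph $\mathcal{G}$ is $h_{\mathcal G}=\max_{z\in V\mathcal{G}}\lim_{r\to\infty}\frac{\log \mathrm{vol}\,B(\tilde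 z,r)}{r}$, where $\tilde z$ is a lift of $z$ to the universal cover $\widetilde{\mathcal{G}}$ and $\mathrm{vol}\,B(\tilde z,r)$ is the total length of the edges (or parts of edges) contained in the metric ball of center $\tilde z$ and radius $r$ in $\widetilde{\mathcal{G}}$.
   Formalization: Two hypotheses are added: the graph obtained by attaching the edge is connected, and either there is a path without backtracking from x to y, or there are such closed paths both at x and at y; without them the identity can fail. Both hold when the original graph is connected. *)

theory Defs
  imports "HOL-Analysis.Analysis" "Graph_Theory.Graph_Theory"
begin

text \<open>
  Finite metric graphs with oriented edges, in the sense of Serre: loops and multiple edges are
  allowed, and every oriented edge is distinct from its reverse.  The locale
  \<^locale>\<open>bidirected_digraph\<close> requires \<open>arev\<close> to fix everything that is not an edge.
\<close>

locale fin_metric_graph = fin_digraph G + bidirected_digraph G arev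
  for G :: "('a, 'b) pre_digraph" and arev :: "'b \<Rightarrow> 'b" +
  fixes len :: "'b \<Rightarrow> real"
  assumes len_pos: "a \<in> arcs G \<Longrightarrow> 0 < len a"
    and len_rev: "a \<in> arcs G \<Longrightarrow> len (arev a) = len a"

definition attach_edge ::
  "('a, 'b) pre_digraph \<Rightarrow> 'a \<Rightarrow> 'a \<Rightarrow> 'b \<Rightarrow> 'b \<Rightarrow> ('a, 'b) pre_digraph" where
  "attach_edge G x y e e' =
    \<lparr> verts = verts G, arcs = arcs G \<union> {e, e'},
      tail = (tail G)(e := x, e' := y), head = (head G)(e := y, e' := x) \<rparr>"

definition no_backtracking :: "('b \<Rightarrow> 'b) \<Rightarrow> 'b list \<Rightarrow> bool" where
  "no_backtracking arev p = successively (\<lambda>a b. b \<noteq> arev a) p"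

definition path_length :: "('b \<Rightarrow> real) \<Rightarrow> 'b list \<Rightarrow> real" where
  "path_length len p = sum_list (map len p)"

definition nb_paths :: "('a, 'b) pre_digraph \<Rightarrow> ('b \<Rightarrow> 'b) \<Rightarrow> 'a \<Rightarrow> 'a \<Rightarrow> 'b list set" where
  "nb_paths G arev z w = {p. p \<noteq> [] \<and> pre_digraph.awalk G z p w \<and> no_backtracking arev p}"

text \<open>
  As \<^const>\<open>infsum\<close> is 0 for a divergent series, a value of the generating function is meaningful
  only together with \<open>gen_fun_converges\<close>.
\<close>

definition gen_fun ::
  "('a, 'b) pre_digraph \<Rightarrow> ('b \<Rightarrow> 'b) \<Rightarrow> ('b \<Rightarrow> real) \<Rightarrow> 'a \<Rightarrow> 'a \<Rightarrow> real \<Rightarrow> real" where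
  "gen_fun G arev len z w t = (\<Sum>\<^sub>\<infinity>p\<in>nb_paths G arev z w. exp (- path_length len p * t))"

definition gen_fun_converges ::
  "('a, 'b) pre_digraph \<Rightarrow> ('b \<Rightarrow> 'b) \<Rightarrow> ('b \<Rightarrow> real) \<Rightarrow> 'a \<Rightarrow> 'a \<Rightarrow> real \<Rightarrow> bool" where
  "gen_fun_converges G arev len z w t \<longleftrightarrow>
    (\<lambda>p. exp (- path_length len p * t)) summable_on nb_paths G arev z w"

text \<open>
  The universal cover of the component of \<open>z\<close>, with base point the lift \<open>[]\<close> of \<open>z\<close>.  Its vertices
  are the walks from \<open>z\<close> without backtracking, the empty walk included; a walk lies over its end
  vertex.  The oriented edge \<open>(p, a)\<close> is the lift of \<open>a\<close> starting at \<open>p\<close>: it leads to the walk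
  \<open>p @ [a]\<close>, or back to \<open>butlast p\<close> if \<open>a\<close> is the reverse of the last edge of \<open>p\<close>.
\<close>

definition universal_cover ::
  "('a, 'b) pre_digraph \<Rightarrow> ('b \<Rightarrow> 'b) \<Rightarrow> 'a \<Rightarrow> ('b list, 'b list \<times> 'b) pre_digraph" where
  "universal_cover G arev z =
    \<lparr> verts = {p. \<exists>w. pre_digraph.awalk G z p w \<and> no_backtracking arev p},
      arcs = {(p, a). pre_digraph.awalk G z p (tail G a) \<and> no_backtracking arev p \<and> a \<in> arcs G},
      tail = fst,
      head = (\<lambda>(p, a). if p \<noteq> [] \<and> a = arev (last p) then butlast p else p @ [a]) \<rparr>"

definition cover_len :: "('b \<Rightarrow> real) \<Rightarrow> 'b list \<times> 'b \<Rightarrow> real" where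
  "cover_len len = (\<lambda>(p, a). len a)"

text \<open>
  The set of points of the oriented edge \<open>a\<close>, parametrized by the distance \<open>s\<close> from its tail, that
  lie in the closed ball of radius \<open>r\<close> about the vertex \<open>c\<close>.  Here \<open>wf_digraph.\<mu>\<close> is the infimum
  of the lengths of the walks between two vertices, i.e. the path metric.
\<close>

definition edge_part ::
  "('a, 'b) pre_digraph \<Rightarrow> ('b \<Rightarrow> real) \<Rightarrow> 'a \<Rightarrow> real \<Rightarrow> 'b \<Rightarrow> real set" where
  "edge_part T len c r a =
    {s \<in> {0..len a}. wf_digraph.\<mu> T len c (tail T a) + ereal s \<le> ereal r \<or>
                     wf_digraph.\<mu> T len c (head T a) + ereal (len a - s) \<le> ereal r}"

text \<open>The factor 1/2 is there because each geometric edge occurs with both orientations.\<close>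

definition vol_ball :: "('a, 'b) pre_digraph \<Rightarrow> ('b \<Rightarrow> real) \<Rightarrow> 'a \<Rightarrow> real \<Rightarrow> real" where
  "vol_ball T len c r = (\<Sum>\<^sub>\<infinity>a\<in>arcs T. measure lborel (edge_part T len c r a)) / 2"

definition volume_entropy ::
  "('a, 'b) pre_digraph \<Rightarrow> ('b \<Rightarrow> 'b) \<Rightarrow> ('b \<Rightarrow> real) \<Rightarrow> real" where
  "volume_entropy G arev len =
    Max ((\<lambda>z. Lim at_top (\<lambda>r. ln (vol_ball (universal_cover G arev z) (cover_len len) [] r) / r))
         ` verts G)"

lemma (in bidirected_digraph) wf_digraph_universal_cover:
  "wf_digraph (universal_cover G arev z)"
proof
  fix e assume e: "e \<in> arcs (universal_cover G arev z)"
  obtain p a where pa: "e = (p, a)" by (cases e)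
  have p: "awalk z p (tail G a)" "no_backtracking arev p" and a: "a \<in> arcs G"
    using e unfolding pa universal_cover_def by auto
  show "tail (universal_cover G arev z) e \<in> verts (universal_cover G arev z)"
    using p unfolding pa universal_cover_def by auto
  show "head (universal_cover G arev z) e \<in> verts (universal_cover G arev z)"
  proof (cases "p \<noteq> [] \<and> a = arev (last p)")
    case True
    then obtain q b where q: "p = q @ [b]" by (metis append_butlast_last_id)
    have "awalk z q (tail G b)" using p(1) unfolding q by auto
    moreover have "no_backtracking arev q"
      using p(2) unfolding q no_backtracking_def by (simp add: successively_append_iff)
    ultimately show ?thesis
      using True unfolding pa universal_cover_def by (auto simp: q)
  next
    case False
    have "awalk z (p @ [a]) (head G a)"
      using p(1) a by (meson arc_implies_awalk awalk_appendI)
    moreover have "no_backtracking arev (p @ [a])"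
      using p(2) False unfolding no_backtracking_def by (auto simp: successively_append_iff)
    ultimately show ?thesis
      using False unfolding pa universal_cover_def by auto
  qed
qed

lemma (in fin_metric_graph) fin_metric_graph_attach_edge:
  assumes "x \<in> verts G" "y \<in> verts G" "e \<notin> arcs G" "e' \<notin> arcs G" "e \<noteq> e'" "0 < l0"
  shows "fin_metric_graph (attach_edge G x y e e') (arev(e := e', e' := e)) (len(e := l0, e' := l0))"
proof -
  have neq: "arev a \<noteq> e \<and> arev a \<noteq> e'" if "a \<in> arcs G" for a
    using that assms arev_in_arcs by metis
  show ?thesis
    using assms neq
    by unfold_locales (auto simp: attach_edge_def len_pos len_rev arev_dom)
qed

end

theory Submission
  imports Defs "HOL-Real_Asymp.Real_Asymp"
begin

text \<open>
  The volume entropy of a connected graph is the critical exponent of the Poincare series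
  \<open>\<Sum> exp (- t l(p))\<close> over all walks \<open>p\<close> without backtracking.  Cutting walks at the first edge that
  reaches length \<open>r\<close> bounds the series at \<open>t\<close> by a geometric series as soon as the walks cut there
  have total weight below 1.  Hence divergence at \<open>t\<close> forces at least \<open>exp (t r)\<close> such
  walks for every \<open>r\<close>, so that the growth rate is a genuine limit; and convergence is an open condition
  in \<open>t\<close>, so that the series diverges at the critical exponent itself.

  Now cut a walk of the extended graph at its passages through the new edge.  The total weights
  \<open>u\<close> and \<open>v\<close> of the continuations after the new edge and after its reverse satisfy
  \<open>u = g + E (f\<^sub>x\<^sub>y u + f\<^sub>y\<^sub>y v)\<close> and \<open>v = g' + E (f\<^sub>x\<^sub>y v + f\<^sub>x\<^sub>x u)\<close> with \<open>E = exp (- l\<^sub>0 t)\<close>, where \<open>g\<close>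
  and \<open>g'\<close> are the positive weights of the walks that avoid the new edge.  A finite nonnegative solution exists iff
  \<open>f\<^sub>x\<^sub>y + sqrt (f\<^sub>x\<^sub>x f\<^sub>y\<^sub>y) < exp (l\<^sub>0 t)\<close>.  At the critical exponent this fails, while the
  weak inequality holds as a limit from above.
\<close>

section \<open>Weights of sets of walks\<close>

lemma path_length_simps [simp]:
  "path_length len [] = 0"
  "path_length len (a # p) = len a + path_length len p"
  "path_length len (p @ q) = path_length len p + path_length len q"
  by (auto simp: path_length_def)

lemma path_length_snoc_butlast:
  "p \<noteq> [] \<Longrightarrow> path_length len p = path_length len (butlast p) + len (last p)"
  by (cases p rule: rev_cases) auto

text \<open>Values in \<^typ>\<open>ennreal\<close> make all identities between weights unconditional.\<close>

definition wt :: "('b \<Rightarrow> real) \<Rightarrow> real \<Rightarrow> 'b list set \<Rightarrow> ennreal" where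
  "wt len t A = (\<integral>\<^sup>+p. ennreal (exp (- path_length len p * t)) \<partial>count_space A)"

lemma wt_empty [simp]: "wt len t {} = 0"
  by (simp add: wt_def nn_integral_empty)

lemma wt_indicator:
  "wt len t A = (\<integral>\<^sup>+p. ennreal (exp (- path_length len p * t)) * indicator A p \<partial>count_space UNIV)"
  unfolding wt_def by (subst nn_integral_count_space_indicator) auto

lemma wt_mono: "A \<subseteq> B \<Longrightarrow> wt len t A \<le> wt len t B"
  unfolding wt_indicator by (intro nn_integral_mono) (auto simp: indicator_def)

lemma wt_Un_disjoint: "A \<inter> B = {} \<Longrightarrow> wt len t (A \<union> B) = wt len t A + wt len t B"
  unfolding wt_indicator
  by (subst nn_integral_add[symmetric]) (auto intro!: nn_integral_cong simp: indicator_def)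

lemma wt_Un_le: "wt len t (A \<union> B) \<le> wt len t A + wt len t B"
proof -
  have "wt len t (A \<union> B) = wt len t A + wt len t (B - A)"
    using wt_Un_disjoint[of A "B - A" len t] by simp
  also have "\<dots> \<le> wt len t A + wt len t B"
    by (intro add_left_mono wt_mono) auto
  finally show ?thesis .
qed

lemma wt_UN_le: "finite I \<Longrightarrow> wt len t (\<Union>i\<in>I. A i) \<le> (\<Sum>i\<in>I. wt len t (A i))"
proof (induction I rule: finite_induct)
  case (insert i I)
  have "wt len t (A i \<union> (\<Union>i\<in>I. A i)) \<le> wt len t (A i) + wt len t (\<Union>i\<in>I. A i)"
    by (rule wt_Un_le)
  also have "\<dots> \<le> wt len t (A i) + (\<Sum>i\<in>I. wt len t (A i))"
    by (intro add_left_mono insert.IH)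
  finally show ?case using insert by simp
qed simp

lemma wt_finite_sum:
  "finite A \<Longrightarrow> wt len t A = ennreal (\<Sum>p\<in>A. exp (- path_length len p * t))"
  by (simp add: wt_def nn_integral_count_space_finite)

lemma wt_finite: "finite A \<Longrightarrow> wt len t A < \<infinity>"
  by (simp add: wt_finite_sum)

lemma wt_singleton [simp]: "wt len t {p} = ennreal (exp (- path_length len p * t))"
  by (simp add: wt_finite_sum)

lemma wt_cong_length:
  "(\<And>p. p \<in> A \<Longrightarrow> path_length len p = path_length len' p) \<Longrightarrow> wt len t A = wt len' t A"
  unfolding wt_def by (intro nn_integral_cong) simp

lemma wt_image_le:
  assumes "\<And>p. p \<in> A \<Longrightarrow> path_length len (f p) = path_length len p"
  shows "wt len t (f ` A) \<le> wt len t A"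
proof -
  \<comment> \<open>The map may identify walks, so a set \<open>B\<close> of representatives with
    the same image is chosen, on which it is injective.\<close>
  obtain B where B: "B \<subseteq> A" "inj_on f B" "f ` A = f ` B"
    by (metis subset_image_inj subset_refl)
  have "wt len t (f ` A) = wt len t B"
    unfolding B wt_def
    by (subst nn_integral_bij_count_space[of f B "f ` B", symmetric])
       (use B assms in \<open>auto simp: bij_betw_def intro!: nn_integral_cong\<close>)
  also have "\<dots> \<le> wt len t A" by (rule wt_mono) (rule B)
  finally show ?thesis .
qed

lemma exp_path_length_append:
  "exp (- (path_length len (p @ q) * t)) = exp (- (path_length len p * t)) * exp (- (path_length len q * t))"
  by (simp add: exp_add[symmetric] distrib_right)

text \<open>The weight is multiplicative under concatenation, so Tonelli's theorem for counting
  measures splits the sum over pairs.\<close>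

lemma wt_times:
  "(\<integral>\<^sup>+(p, q). ennreal (exp (- path_length len (p @ q) * t)) \<partial>count_space (A \<times> B))
    = wt len t A * wt len t B"
proof -
  let ?w = "\<lambda>p. ennreal (exp (- path_length len p * t))"
  have "(\<integral>\<^sup>+(p, q). ennreal (exp (- path_length len (p @ q) * t)) \<partial>count_space (A \<times> B))
      = (\<integral>\<^sup>+x. (case x of (p, q) \<Rightarrow> (?w p * indicator A p) * (?w q * indicator B q)) \<partial>count_space UNIV)"
    by (subst nn_integral_count_space_indicator)
       (auto intro!: nn_integral_cong simp: indicator_def exp_path_length_append ennreal_mult
         simp del: path_length_simps)
  also have "\<dots> = (\<integral>\<^sup>+p. (\<integral>\<^sup>+q. (?w p * indicator A p) * (?w q * indicator B q) \<partial>count_space UNIV)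
      \<partial>count_space UNIV)"
    by (subst nn_integral_fst_count_space[symmetric]) simp
  also have "\<dots> = wt len t A * wt len t B"
    by (simp add: nn_integral_cmult nn_integral_multc wt_indicator)
  finally show ?thesis .
qed

lemma wt_concat:
  assumes "inj_on (\<lambda>(p, q). p @ q) (A \<times> B)"
  shows "wt len t ((\<lambda>(p, q). p @ q) ` (A \<times> B)) = wt len t A * wt len t B"
proof -
  have "wt len t ((\<lambda>(p, q). p @ q) ` (A \<times> B)) =
      (\<integral>\<^sup>+x. ennreal (exp (- path_length len (case x of (p, q) \<Rightarrow> p @ q) * t)) \<partial>count_space (A \<times> B))"
    unfolding wt_def
    by (rule nn_integral_bij_count_space[symmetric]) (use assms in \<open>simp add: bij_betw_def\<close>)
  also have "\<dots> = wt len t A * wt len t B"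
    unfolding wt_times[symmetric] by (intro nn_integral_cong) (auto simp del: path_length_simps)
  finally show ?thesis .
qed

text \<open>A word may be cut in several ways. One pair is kept for each word, and the discarded
  pairs only enlarge the right-hand side.\<close>

lemma wt_concat_le: "wt len t ((\<lambda>(p, q). p @ q) ` (A \<times> B)) \<le> wt len t A * wt len t B"
proof -
  obtain C where C: "C \<subseteq> A \<times> B" "inj_on (\<lambda>(p, q). p @ q) C"
      "(\<lambda>(p, q). p @ q) ` (A \<times> B) = (\<lambda>(p, q). p @ q) ` C"
    by (metis subset_image_inj subset_refl)
  have "wt len t ((\<lambda>(p, q). p @ q) ` (A \<times> B)) =
      (\<integral>\<^sup>+x. ennreal (exp (- path_length len (case x of (p, q) \<Rightarrow> p @ q) * t)) \<partial>count_space C)"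
    unfolding wt_def C(3)
    by (rule nn_integral_bij_count_space[symmetric]) (use C in \<open>simp add: bij_betw_def\<close>)
  also have "\<dots> \<le> (\<integral>\<^sup>+(p, q). ennreal (exp (- path_length len (p @ q) * t)) \<partial>count_space (A \<times> B))"
    using C(1)
    by (subst (1 2) nn_integral_count_space_indicator)
       (auto intro!: nn_integral_mono simp: indicator_def simp del: path_length_simps)
  finally show ?thesis unfolding wt_times .
qed

lemma wt_Cons_image: "wt len t ((#) a ` A) = ennreal (exp (- len a * t)) * wt len t A"
proof -
  have "(#) a ` A = (\<lambda>(p, q). p @ q) ` ({[a]} \<times> A)" by (auto simp: image_iff)
  moreover have "inj_on (\<lambda>(p, q). p @ q) ({[a]} \<times> A)" by (auto simp: inj_on_def)
  ultimately show ?thesis using wt_concat[of "{[a]}" A len t] by simp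
qed

lemma wt_snoc_image: "wt len t ((\<lambda>p. p @ [a]) ` A) = ennreal (exp (- len a * t)) * wt len t A"
proof -
  have "(\<lambda>p. p @ [a]) ` A = (\<lambda>(p, q). p @ q) ` (A \<times> {[a]})" by (auto simp: image_iff)
  moreover have "inj_on (\<lambda>(p, q). p @ q) (A \<times> {[a]})" by (auto simp: inj_on_def)
  ultimately show ?thesis using wt_concat[of A "{[a]}" len t] by (simp add: mult.commute)
qed

lemma wt_antimono_time:
  assumes "t \<le> t'" "\<And>p. p \<in> A \<Longrightarrow> 0 \<le> path_length len p"
  shows "wt len t' A \<le> wt len t A"
  unfolding wt_def using assms by (intro nn_integral_mono ennreal_leI) (auto simp: mult_left_mono)

text \<open>For nonnegative terms, unconditional summability is integrability over the counting
  measure. This is the bridge between \<open>wt\<close> and the generating functions.\<close>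

lemma summable_iff_wt_finite:
  "(\<lambda>p. exp (- path_length len p * t)) summable_on A \<longleftrightarrow> wt len t A < \<infinity>"
proof -
  let ?w = "\<lambda>p. exp (- path_length len p * t)"
  have "?w summable_on A \<longleftrightarrow> integrable (count_space A) ?w"
    using abs_summable_equivalent[of ?w A] by (simp add: abs_summable_on_def)
  also have "\<dots> \<longleftrightarrow> wt len t A < \<infinity>"
    by (simp add: integrable_iff_bounded wt_def)
  finally show ?thesis .
qed

lemma wt_eq_infsum:
  assumes "wt len t A < \<infinity>"
  shows "wt len t A = ennreal (\<Sum>\<^sub>\<infinity>p\<in>A. exp (- path_length len p * t))"
proof -
  let ?w = "\<lambda>p. exp (- path_length len p * t)"
  have s: "?w summable_on A" using assms by (simp only: summable_iff_wt_finite)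
  then have *: "Infinite_Set_Sum.abs_summable_on ?w A"
    by (subst abs_summable_equivalent[symmetric]) simp
  then have "wt len t A = ennreal (\<integral>p. ?w p \<partial>count_space A)"
    unfolding wt_def abs_summable_on_def by (intro nn_integral_eq_integral) auto
  also have "(\<integral>p. ?w p \<partial>count_space A) = infsum ?w A"
    using infsetsum_infsum[OF *] by (simp add: infsetsum_def)
  finally show ?thesis .
qed

text \<open>Passes from truncated sets of walks, whose weight is finite from the outset, to the
  whole set.\<close>

lemma wt_le_if_finite_subsets:
  assumes "\<And>S. finite S \<Longrightarrow> S \<subseteq> A \<Longrightarrow> wt len t S \<le> ennreal C" and "0 \<le> C"
  shows "wt len t A \<le> ennreal C"
proof -
  let ?w = "\<lambda>p. exp (- path_length len p * t)"
  have le: "sum ?w S \<le> C" if "finite S" "S \<subseteq> A" for S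
    using assms(1)[OF that] assms(2) that by (simp add: wt_finite_sum)
  have s: "?w summable_on A"
    by (rule nonneg_bdd_above_summable_on) (use le in \<open>auto simp: bdd_above_def\<close>)
  then have "wt len t A = ennreal (infsum ?w A)"
    by (intro wt_eq_infsum) (simp only: summable_iff_wt_finite)
  also have "infsum ?w A \<le> C"
    by (rule infsum_le_finite_sums[OF s]) (use le in auto)
  finally show ?thesis by (simp add: ennreal_leI)
qed

text \<open>The tail of a convergent series is small. The value 1 is the threshold below which a
  geometric series converges.\<close>

lemma wt_complement_small:
  assumes "wt len t A < \<infinity>"
  obtains S where "finite S" "S \<subseteq> A" "wt len t (A - S) < 1"
proof -
  let ?w = "\<lambda>p. exp (- path_length len p * t)"
  have s: "?w summable_on A" using assms by (simp only: summable_iff_wt_finite)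
  obtain S where S: "finite S" "S \<subseteq> A" "infsum ?w A - 1 < sum ?w S"
  proof (rule ccontr)
    assume "\<not> thesis"
    then have "sum ?w S \<le> infsum ?w A - 1" if "finite S" "S \<subseteq> A" for S
      using that \<open>\<And>S. finite S \<Longrightarrow> S \<subseteq> A \<Longrightarrow> infsum ?w A - 1 < sum ?w S \<Longrightarrow> thesis\<close>
      by fastforce
    then have "infsum ?w A \<le> infsum ?w A - 1" by (intro infsum_le_finite_sums[OF s]) auto
    then show False by simp
  qed
  have s': "?w summable_on (A - S)"
    by (rule summable_on_subset_banach[OF s]) auto
  have "infsum ?w (A - S) = infsum ?w A - sum ?w S"
    using infsum_Diff[OF s _ S(2)] S(1) by simp
  then have "infsum ?w (A - S) < 1" using S(3) by simp
  moreover have "wt len t (A - S) = ennreal (infsum ?w (A - S))"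
    using s' by (intro wt_eq_infsum) (simp only: summable_iff_wt_finite)
  ultimately show thesis using S by (intro that) (auto simp: ennreal_less_one_iff)
qed

section \<open>The critical exponent\<close>

text \<open>For \<open>0 < q\<close> an infinite \<open>x\<close> satisfies the inequality as well,
  so finiteness has to be known first. Hence the lemma is applied to truncations, with a bound that
  does not depend on the truncation.\<close>

lemma ennreal_affine_bound:
  fixes x :: ennreal
  assumes "x \<le> ennreal a + ennreal q * x" "x < \<infinity>" "0 \<le> a" "0 \<le> q" "q < 1"
  shows "x \<le> ennreal (a / (1 - q))"
proof -
  obtain y where y: "x = ennreal y" "0 \<le> y" using assms(2) by (cases x) auto
  have "y \<le> a + q * y"
    using assms y by (simp add: ennreal_mult[symmetric] ennreal_plus[symmetric] del: ennreal_plus)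
  then have "y \<le> a / (1 - q)" using assms by (simp add: field_simps)
  then show ?thesis by (simp add: y ennreal_leI)
qed

section \<open>Reduced walks, and cutting them at a given length\<close>

context fin_metric_graph
begin

text \<open>The nonempty reduced words are the nonempty walks without backtracking, taken without
  naming their end points; prefixes and suffixes are then reduced again.\<close>

definition reduced :: "'b list \<Rightarrow> bool" where
  "reduced p \<longleftrightarrow> set p \<subseteq> arcs G \<and> successively (\<lambda>a b. head G a = tail G b \<and> b \<noteq> arev a) p"

definition walks_from :: "'a \<Rightarrow> 'b list set" where
  "walks_from z = {p. reduced p \<and> (p \<noteq> [] \<longrightarrow> tail G (hd p) = z)}"

lemma reduced_Nil [simp]: "reduced []"
  by (simp add: reduced_def)

lemma reduced_Cons:
  "reduced (a # p) \<longleftrightarrow>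
    a \<in> arcs G \<and> reduced p \<and> (p \<noteq> [] \<longrightarrow> head G a = tail G (hd p) \<and> hd p \<noteq> arev a)"
  by (auto simp: reduced_def successively_Cons)

lemma reduced_append:
  "reduced (p @ q) \<longleftrightarrow> reduced p \<and> reduced q \<and>
    (p \<noteq> [] \<longrightarrow> q \<noteq> [] \<longrightarrow> head G (last p) = tail G (hd q) \<and> hd q \<noteq> arev (last p))"
  by (auto simp: reduced_def successively_append_iff)

lemma cas_iff_successively:
  "p \<noteq> [] \<Longrightarrow> cas z p w \<longleftrightarrow>
    tail G (hd p) = z \<and> successively (\<lambda>a b. head G a = tail G b) p \<and> head G (last p) = w"
proof (induction p arbitrary: z)
  case (Cons a p)
  show ?case
  proof (cases "p = []")
    case False
    then show ?thesis using Cons.IH[of "head G a"] by (simp add: successively_Cons) metis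
  qed auto
qed simp

lemma awalk_no_backtracking_iff:
  assumes "p \<noteq> []"
  shows "awalk z p w \<and> no_backtracking arev p \<longleftrightarrow>
    reduced p \<and> tail G (hd p) = z \<and> head G (last p) = w"
proof -
  have "successively (\<lambda>a b. P a b \<and> Q a b) p \<longleftrightarrow> successively P p \<and> successively Q p" for P Q
    by (induction p) (auto simp: successively_Cons)
  then show ?thesis
    using assms unfolding awalk_def no_backtracking_def cas_iff_successively[OF assms] reduced_def
    by (cases p) auto
qed

lemma nb_paths_eq:
  "nb_paths G arev z w = {p. p \<noteq> [] \<and> reduced p \<and> tail G (hd p) = z \<and> head G (last p) = w}"
  using awalk_no_backtracking_iff unfolding nb_paths_def by blast

lemma path_length_nonneg: "reduced p \<Longrightarrow> 0 \<le> path_length len p"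
  by (auto simp: path_length_def reduced_def intro!: sum_list_nonneg less_imp_le[OF len_pos])

lemma len_lower_bound: obtains m where "0 < m" "\<And>a. a \<in> arcs G \<Longrightarrow> m \<le> len a"
proof
  \<comment> \<open>\<open>insert 1\<close> keeps the minimum meaningful for a graph without
    edges.\<close>
  show "0 < Min (insert 1 (len ` arcs G))" by (simp add: len_pos)
  show "Min (insert 1 (len ` arcs G)) \<le> len a" if "a \<in> arcs G" for a
    using that by (intro Min_le) auto
qed

lemma len_upper_bound: obtains M where "0 < M" "\<And>a. a \<in> arcs G \<Longrightarrow> len a \<le> M"
proof
  show "0 < Max (insert 1 (len ` arcs G))" by (simp add: Max_gr_iff)
  show "len a \<le> Max (insert 1 (len ` arcs G))" if "a \<in> arcs G" for a
    using that by (intro Max_ge) auto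
qed

lemma finite_reduced_length_le: "finite {p. reduced p \<and> length p \<le> n}"
  by (rule finite_subset[OF _ finite_lists_length_le[OF finite_arcs, of n]]) (auto simp: reduced_def)

text \<open>Every edge costs at least the smallest edge length \<open>m\<close>, so length at most
  \<open>r\<close> leaves room for at most \<open>r / m\<close> edges.\<close>

lemma finite_reduced_short: "finite {p. reduced p \<and> path_length len p \<le> r}"
proof -
  obtain m where m: "0 < m" "\<And>a. a \<in> arcs G \<Longrightarrow> m \<le> len a" by (rule len_lower_bound) blast
  have *: "m * length p \<le> path_length len p" if "reduced p" for p
    using that by (induction p) (auto simp: reduced_Cons algebra_simps intro: add_mono m(2))
  have "{p. reduced p \<and> path_length len p \<le> r} \<subseteq> {p. reduced p \<and> length p \<le> nat \<lfloor>r / m\<rfloor>}"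
  proof safe
    fix p assume p: "reduced p" "path_length len p \<le> r"
    then have "real (length p) \<le> r / m" using *[OF p(1)] m(1) by (simp add: field_simps)
    then show "length p \<le> nat \<lfloor>r / m\<rfloor>" by linarith
  qed
  then show ?thesis using finite_reduced_length_le finite_subset by blast
qed

text \<open>Walks stopped at the edge on which their length first reaches \<open>r\<close>. Edge
  lengths are positive, so the condition on \<open>butlast p\<close> covers all proper
  prefixes.\<close>

definition crossing :: "real \<Rightarrow> 'b list set" where
  "crossing r = {p. p \<noteq> [] \<and> reduced p \<and> path_length len (butlast p) < r \<and> r \<le> path_length len p}"

lemma crossing_length_le:
  assumes "p \<in> crossing r" "\<And>a. a \<in> arcs G \<Longrightarrow> len a \<le> M"
  shows "path_length len p \<le> r + M"
proof -
  obtain q a where q: "p = q @ [a]" using assms(1) by (cases p rule: rev_cases) (auto simp: crossing_def)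
  then have "a \<in> arcs G" using assms(1) by (auto simp: crossing_def reduced_append reduced_Cons)
  then show ?thesis using assms by (auto simp: q crossing_def dest!: assms(2))
qed

lemma finite_crossing: "finite (crossing r)"
proof -
  obtain M where "\<And>a. a \<in> arcs G \<Longrightarrow> len a \<le> M" by (rule len_upper_bound) blast
  then have "crossing r \<subseteq> {p. reduced p \<and> path_length len p \<le> r + M}"
    using crossing_length_le by (auto simp: crossing_def)
  then show ?thesis using finite_reduced_short finite_subset by blast
qed

lemma reduced_decomp_crossing:
  assumes "reduced p" "r \<le> path_length len p" "0 < r"
  shows "\<exists>q s. p = q @ s \<and> q \<in> crossing r \<and> reduced s"
  using assms
proof (induction p rule: rev_induct)
  case (snoc a p)
  show ?case
  proof (cases "r \<le> path_length len p")
    case True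
    then obtain q s where "p = q @ s" "q \<in> crossing r" using snoc by (auto simp: reduced_append)
    then show ?thesis using snoc(2) by (intro exI[of _ q] exI[of _ "s @ [a]"]) (auto simp: reduced_append)
  next
    case False
    then show ?thesis using snoc by (intro exI[of _ "p @ [a]"] exI[of _ "[]"]) (auto simp: crossing_def)
  qed
qed simp

text \<open>A reduced walk longer than \<open>r\<close> is a crossing walk followed by a reduced
  walk with no more edges. So the weight \<open>x\<close> of the walks with at most \<open>n\<close>
  edges satisfies \<open>x <= a + q * x\<close>, where \<open>a\<close> is the weight of the short
  walks and \<open>q < 1\<close> that of \<open>crossing r\<close>; the resulting bound is uniform
  in \<open>n\<close>.\<close>

lemma wt_reduced_finite_if_crossing:
  assumes "0 < r" "wt len t (crossing r) < 1"
  shows "wt len t (Collect reduced) < \<infinity>"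
proof -
  let ?S = "{p. reduced p \<and> path_length len p \<le> r}"
  obtain a where a: "wt len t ?S = ennreal a" "0 \<le> a"
    using wt_finite[OF finite_reduced_short, of len t r] by (cases "wt len t ?S") auto
  obtain q where q: "wt len t (crossing r) = ennreal q" "0 \<le> q" "q < 1"
    using assms(2) by (cases "wt len t (crossing r)") (auto simp: ennreal_less_one_iff)
  have bound: "wt len t {p. reduced p \<and> length p \<le> n} \<le> ennreal (a / (1 - q))" for n
  proof (rule ennreal_affine_bound)
    let ?C = "{p. reduced p \<and> length p \<le> n}"
    have "?C \<subseteq> ?S \<union> (\<lambda>(p, q). p @ q) ` (crossing r \<times> ?C)"
    proof
      fix p assume p: "p \<in> ?C"
      show "p \<in> ?S \<union> (\<lambda>(p, q). p @ q) ` (crossing r \<times> ?C)"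
      proof (cases "path_length len p \<le> r")
        case False
        then obtain q s where "p = q @ s" "q \<in> crossing r" "reduced s"
          using reduced_decomp_crossing[of p r] p assms(1) by auto
        then show ?thesis using p by (intro UnI2 image_eqI[of _ _ "(q, s)"]) auto
      qed (use p in auto)
    qed
    then have "wt len t ?C \<le> wt len t (?S \<union> (\<lambda>(p, q). p @ q) ` (crossing r \<times> ?C))" by (rule wt_mono)
    also have "\<dots> \<le> wt len t ?S + wt len t ((\<lambda>(p, q). p @ q) ` (crossing r \<times> ?C))" by (rule wt_Un_le)
    also have "\<dots> \<le> wt len t ?S + wt len t (crossing r) * wt len t ?C" by (intro add_left_mono wt_concat_le)
    finally show "wt len t ?C \<le> ennreal a + ennreal q * wt len t ?C" by (simp add: a q)
  qed (use wt_finite[OF finite_reduced_length_le] a q in auto)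
  have "wt len t (Collect reduced) \<le> ennreal (a / (1 - q))"
  proof (rule wt_le_if_finite_subsets)
    fix S assume S: "finite S" "S \<subseteq> Collect reduced"
    then have "S \<subseteq> {p. reduced p \<and> length p \<le> Max (insert 0 (length ` S))}" by auto
    then show "wt len t S \<le> ennreal (a / (1 - q))" using bound wt_mono order_trans by blast
  qed (use a q in simp)
  then show ?thesis by (simp add: le_less_trans)
qed

text \<open>A finite set \<open>S\<close> carries all but less than 1 of the total weight, and for
  \<open>r\<close> beyond all lengths occurring in \<open>S\<close> the crossing walks avoid
  \<open>S\<close>.\<close>

lemma wt_crossing_lt_1_if_finite:
  assumes "wt len t (Collect reduced) < \<infinity>"
  shows "\<exists>r>0. wt len t (crossing r) < 1"
proof -
  obtain S where S: "finite S" "wt len t (Collect reduced - S) < 1"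
    using wt_complement_small[OF assms] by metis
  define r where "r = Max (insert 0 (path_length len ` S)) + 1"
  have r: "path_length len p < r" if "p \<in> S" for p
    unfolding r_def using S(1) that by (intro le_less_trans[OF Max_ge less_add_one]) auto
  have "0 < r" unfolding r_def using S(1) by (intro le_less_trans[OF Max_ge less_add_one]) auto
  moreover have "crossing r \<subseteq> Collect reduced - S" using r by (fastforce simp: crossing_def)
  ultimately show ?thesis using S(2) wt_mono le_less_trans by blast
qed

text \<open>Convergence is equivalent to a strict inequality for some finite sum over
  \<open>crossing r\<close>, and such a sum is continuous in \<open>t\<close>, so the inequality
  survives slightly to the left.\<close>

lemma wt_reduced_finite_left:
  assumes "wt len t (Collect reduced) < \<infinity>"
  shows "\<exists>t'<t. wt len t' (Collect reduced) < \<infinity>"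
proof -
  obtain r where r: "0 < r" "wt len t (crossing r) < 1" using wt_crossing_lt_1_if_finite[OF assms] by blast
  let ?q = "\<lambda>t. \<Sum>p\<in>crossing r. exp (- path_length len p * t)"
  have eq: "wt len t (crossing r) = ennreal (?q t)" for t by (rule wt_finite_sum[OF finite_crossing])
  have "?q t < 1" using r(2) unfolding eq by (simp add: ennreal_less_one_iff)
  moreover have "(?q \<longlongrightarrow> ?q t) (at_left t)" by (intro tendsto_intros)
  ultimately have "\<forall>\<^sub>F t' in at_left t. ?q t' < 1" by (simp add: order_tendstoD(2))
  then obtain b where b: "b < t" "\<And>s. b < s \<Longrightarrow> s < t \<Longrightarrow> ?q s < 1"
    using eventually_at_left[of "t - 1" t] by auto
  obtain t' where "b < t'" "t' < t" using dense[OF b(1)] by blast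
  have "?q t' < 1" by (rule b(2)) fact+
  then have "wt len t' (crossing r) < 1" unfolding eq by (simp add: ennreal_less_one_iff)
  then show ?thesis using wt_reduced_finite_if_crossing[OF r(1)] \<open>t' < t\<close> by blast
qed

text \<open>The finitely many walks in \<open>crossing 1\<close> have positive length, so their
  total weight tends to 0.\<close>

lemma wt_reduced_eventually_finite: "\<exists>t. wt len t (Collect reduced) < \<infinity>"
proof -
  let ?q = "\<lambda>t. \<Sum>p\<in>crossing 1. exp (- path_length len p * t)"
  have exp_to_0: "((\<lambda>t. exp (- c * t)) \<longlongrightarrow> 0) at_top" if "0 < c" for c :: real
    using that by real_asymp
  have "(?q \<longlongrightarrow> (\<Sum>p\<in>crossing 1. 0)) at_top"
  proof (rule tendsto_sum)
    fix p assume "p \<in> crossing 1"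
    then have "0 < path_length len p" by (auto simp: crossing_def)
    then show "((\<lambda>t. exp (- path_length len p * t)) \<longlongrightarrow> 0) at_top"
      using exp_to_0 by blast
  qed
  then have "\<forall>\<^sub>F t in at_top. ?q t < 1" by (intro order_tendstoD(2)) auto
  then obtain t where "?q t < 1" by (metis (mono_tags, lifting) eventually_at_top_linorder order_refl)
  then show ?thesis
    using wt_reduced_finite_if_crossing[of 1 t]
    by (simp add: wt_finite_sum[OF finite_crossing] ennreal_less_one_iff) blast
qed

text \<open>\<open>h\<close> is the infimum of the exponents of convergence. Divergence at 0 bounds
  this set below by 0, and convergence at the infimum would extend to its left.\<close>

lemma critical_exponent_exists:
  assumes "wt len 0 (Collect reduced) = \<infinity>"
  obtains h where "0 \<le> h" "wt len h (Collect reduced) = \<infinity>"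
    "\<And>t. h < t \<Longrightarrow> wt len t (Collect reduced) < \<infinity>"
proof -
  let ?S = "{t. wt len t (Collect reduced) < \<infinity>}"
  have up: "t' \<in> ?S" if "t \<in> ?S" "t \<le> t'" for t t'
    using that wt_antimono_time[of t t' "Collect reduced" len] path_length_nonneg
    by (auto intro: le_less_trans)
  have ne: "?S \<noteq> {}" using wt_reduced_eventually_finite by blast
  have lb: "0 \<le> t" if "t \<in> ?S" for t using up[OF that, of 0] assms by force
  have bdd: "bdd_below ?S" using lb by (auto simp: bdd_below_def)
  show thesis
  proof
    show "0 \<le> Inf ?S" using lb ne by (intro cInf_greatest) auto
    show "wt len t (Collect reduced) < \<infinity>" if lt: "Inf ?S < t" for t
    proof -
      obtain s where "s \<in> ?S" "s < t" using cInf_lessD[OF ne lt] by (elim bexE)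
      then have "t \<in> ?S" by (intro up[of s t]) simp_all
      then show ?thesis by (rule CollectD)
    qed
    show "wt len (Inf ?S) (Collect reduced) = \<infinity>"
    proof (rule ccontr)
      assume "wt len (Inf ?S) (Collect reduced) \<noteq> \<infinity>"
      then have "wt len (Inf ?S) (Collect reduced) < \<infinity>" by (simp add: less_top)
      from wt_reduced_finite_left[OF this]
      obtain t' where "t' < Inf ?S" "t' \<in> ?S" by auto
      then show False using cInf_lower[OF _ bdd, of t'] by linarith
    qed
  qed
qed

end

section \<open>Volume entropy as critical exponent\<close>

text \<open>Multiplicative constants contribute \<open>ln C / r\<close> after taking logarithms,
  which vanishes in the limit. The upper bound is asked only for each \<open>t > h\<close>, since
  the series may diverge at \<open>h\<close> itself.\<close>

lemma tendsto_ln_div_at_top: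
  fixes f :: "real \<Rightarrow> real" and h :: real
  assumes "0 < c" and lower: "\<forall>\<^sub>F r in at_top. c * exp (h * r) \<le> f r"
    and upper: "\<And>t. h < t \<Longrightarrow> \<exists>C>0. \<forall>\<^sub>F r in at_top. f r \<le> C * exp (t * r)"
  shows "((\<lambda>r. ln (f r) / r) \<longlongrightarrow> h) at_top"
proof -
  have lim: "((\<lambda>r. t + ln C / r) \<longlongrightarrow> t) at_top" for t C :: real
    by real_asymp
  show ?thesis
  proof (rule order_tendstoI)
    fix a assume "a < h"
    then have "\<forall>\<^sub>F r in at_top. a < h + ln c / r" using order_tendstoD(1)[OF lim] by blast
    then show "\<forall>\<^sub>F r in at_top. a < ln (f r) / r"
      using lower eventually_gt_at_top[of 0]
    proof eventually_elim
      case (elim r)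
      have "ln c + h * r = ln (c * exp (h * r))" using assms(1) by (simp add: ln_mult)
      also have "\<dots> \<le> ln (f r)" using assms(1) elim
        by (intro ln_mono) (auto intro: less_le_trans[OF mult_pos_pos])
      finally have "(ln c + h * r) / r \<le> ln (f r) / r" using elim(3) by (intro divide_right_mono) auto
      then have "h + ln c / r \<le> ln (f r) / r" using elim(3) by (simp add: add_divide_distrib)
      then show ?case using elim by linarith
    qed
  next
    fix b assume "h < b"
    then obtain t where t: "h < t" "t < b" using dense by blast
    obtain C where C: "0 < C" "\<forall>\<^sub>F r in at_top. f r \<le> C * exp (t * r)" using upper[OF t(1)] by blast
    have "\<forall>\<^sub>F r in at_top. t + ln C / r < b" using order_tendstoD(2)[OF lim t(2)] by blast
    then show "\<forall>\<^sub>F r in at_top. ln (f r) / r < b"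
      using lower C(2) eventually_gt_at_top[of 0]
    proof eventually_elim
      case (elim r)
      have "0 < c * exp (h * r)" using assms(1) by simp
      then have "0 < f r" using elim(2) by linarith
      then have "ln (f r) \<le> ln (C * exp (t * r))" using elim by (intro ln_mono) auto
      also have "\<dots> = ln C + t * r" using C(1) by (simp add: ln_mult)
      finally have "ln (f r) / r \<le> t + ln C / r" using elim(4) by (simp add: field_simps)
      then show ?case using elim by linarith
    qed
  qed
qed

section \<open>Change of base point, and counting of walks up to a given length\<close>

context fin_metric_graph
begin

text \<open>A walk starting at the head of \<open>a\<close> can be prefixed by \<open>a\<close>,
  unless it begins with \<open>arev a\<close>, which is then deleted. Both operations are injective
  and change the length by \<open>len a\<close>, so adjacent base points are comparable.\<close>

lemma walks_from_step:
  assumes "a \<in> arcs G"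
  shows "walks_from (head G a) \<subseteq>
    {[]} \<union> (#) (arev a) ` walks_from (tail G a) \<union> {p. a # p \<in> walks_from (tail G a)}"
proof
  fix p assume p: "p \<in> walks_from (head G a)"
  show "p \<in> {[]} \<union> (#) (arev a) ` walks_from (tail G a) \<union> {p. a # p \<in> walks_from (tail G a)}"
  proof (cases p)
    case (Cons b q)
    show ?thesis
    proof (cases "b = arev a")
      case True
      then have "q \<in> walks_from (tail G a)" using p assms by (auto simp: Cons walks_from_def reduced_Cons)
      then show ?thesis using True by (auto simp: Cons)
    next
      case False
      then have "a # p \<in> walks_from (tail G a)" using p assms by (auto simp: Cons walks_from_def reduced_Cons)
      then show ?thesis by simp
    qed
  qed simp
qed

lemma wt_tails_finite:
  assumes "wt len t A < \<infinity>" "\<And>p. p \<in> B \<Longrightarrow> a # p \<in> A"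
  shows "wt len t B < \<infinity>"
proof -
  have "ennreal (exp (- len a * t)) * wt len t B \<le> wt len t A"
    unfolding wt_Cons_image[symmetric] using assms(2) by (intro wt_mono) auto
  also note assms(1)
  finally show ?thesis by (auto simp: ennreal_mult_less_top ennreal_eq_0_iff)
qed

lemma wt_walks_from_reachable:
  assumes "z \<rightarrow>\<^sup>*\<^bsub>G\<^esub> w" "wt len t (walks_from z) < \<infinity>"
  shows "wt len t (walks_from w) < \<infinity>"
  using assms
proof (induction rule: reachable_induct)
  case (step u v)
  then obtain a where a: "a \<in> arcs G" "tail G a = u" "head G a = v"
    by (auto simp: arcs_ends_def arc_to_ends_def)
  have IH: "wt len t (walks_from u) < \<infinity>" using step by blast
  let ?A = "(#) (arev a) ` walks_from u" and ?B = "{p. a # p \<in> walks_from u}"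
  have A: "wt len t ?A < \<infinity>"
    unfolding wt_Cons_image using IH by (simp add: ennreal_mult_less_top)
  have B: "wt len t ?B < \<infinity>" by (rule wt_tails_finite[OF IH]) auto
  have "wt len t (walks_from v) \<le> wt len t ({[]} \<union> ?A \<union> ?B)"
    using walks_from_step[OF a(1)] a by (intro wt_mono) auto
  also have "\<dots> \<le> wt len t ({[]} \<union> ?A) + wt len t ?B" by (rule wt_Un_le)
  also have "\<dots> \<le> wt len t {[]} + wt len t ?A + wt len t ?B" by (intro add_right_mono wt_Un_le)
  also have "\<dots> < \<infinity>" using A B by simp
  finally show ?case .
qed simp

lemma reduced_subset_UN_walks_from: "Collect reduced \<subseteq> {[]} \<union> (\<Union>z\<in>verts G. walks_from z)"
proof
  fix p assume "p \<in> Collect reduced"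
  then show "p \<in> {[]} \<union> (\<Union>z\<in>verts G. walks_from z)"
    by (cases p) (auto simp: walks_from_def reduced_Cons)
qed

lemma wt_reduced_finite_if_walks_from:
  assumes "z \<in> verts G" "\<And>w. w \<in> verts G \<Longrightarrow> z \<rightarrow>\<^sup>*\<^bsub>G\<^esub> w" "wt len t (walks_from z) < \<infinity>"
  shows "wt len t (Collect reduced) < \<infinity>"
proof -
  have "wt len t (Collect reduced) \<le> wt len t {[]} + (\<Sum>w\<in>verts G. wt len t (walks_from w))"
    using wt_mono[OF reduced_subset_UN_walks_from, of len t] wt_Un_le[of len t "{[]}" "\<Union>z\<in>verts G. walks_from z"]
      add_left_mono[OF wt_UN_le[OF finite_verts, of len t walks_from], of "wt len t {[]}"]
    by (meson order_trans)
  also have "\<dots> < \<infinity>"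
    using wt_walks_from_reachable[OF assms(2) assms(3)] wt_finite[of "{[]}" len t]
    by simp
  finally show ?thesis .
qed

definition short_walks :: "'a \<Rightarrow> real \<Rightarrow> 'b list set" where
  "short_walks z r = {p \<in> walks_from z. path_length len p \<le> r}"

lemma finite_short_walks: "finite (short_walks z r)"
  by (rule finite_subset[OF _ finite_reduced_short[of r]]) (auto simp: short_walks_def walks_from_def)

lemma Nil_in_short_walks: "0 \<le> r \<Longrightarrow> [] \<in> short_walks z r"
  by (simp add: short_walks_def walks_from_def)

lemma short_walks_mono: "r \<le> r' \<Longrightarrow> short_walks z r \<subseteq> short_walks z r'"
  by (auto simp: short_walks_def)

text \<open>Each of the three pieces of \<open>walks_from_step\<close> has at most as many elements
  as the set on the right, which contains the empty walk; hence the factor 3.\<close>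

lemma card_short_walks_step:
  assumes "a \<in> arcs G" "0 \<le> r"
  shows "card (short_walks (head G a) r) \<le> 3 * card (short_walks (tail G a) (r + len a))"
proof -
  let ?S = "short_walks (tail G a) (r + len a)"
  have "short_walks (head G a) r \<subseteq> {[]} \<union> (#) (arev a) ` ?S \<union> tl ` ?S"
  proof
    fix p assume p: "p \<in> short_walks (head G a) r"
    then consider "p = []" | q where "p = arev a # q" "q \<in> walks_from (tail G a)" | "a # p \<in> walks_from (tail G a)"
      using walks_from_step[OF assms(1)] unfolding short_walks_def by blast
    then show "p \<in> {[]} \<union> (#) (arev a) ` ?S \<union> tl ` ?S"
    proof cases
      case (2 q)
      then have "q \<in> ?S" using p assms(1) len_pos[OF assms(1)]
        by (auto simp: short_walks_def len_rev)
      then show ?thesis using 2 by simp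
    next
      case 3
      then have "a # p \<in> ?S" using p by (auto simp: short_walks_def)
      then have "tl (a # p) \<in> tl ` ?S" by (rule imageI)
      then show ?thesis by simp
    qed simp
  qed
  then have "card (short_walks (head G a) r) \<le> card ({[]} \<union> (#) (arev a) ` ?S \<union> tl ` ?S)"
    by (intro card_mono) (auto simp: finite_short_walks)
  also have "\<dots> \<le> card ({[]} \<union> (#) (arev a) ` ?S) + card (tl ` ?S)" by (rule card_Un_le)
  also have "\<dots> \<le> (card {[] :: 'b list} + card ((#) (arev a) ` ?S)) + card (tl ` ?S)"
    by (intro add_right_mono card_Un_le)
  also have "\<dots> \<le> (1 + card ?S) + card ?S"
    by (intro add_mono card_image_le finite_short_walks) auto
  also have "1 \<le> card ?S"
    using Nil_in_short_walks[of "r + len a" "tail G a"] assms len_pos[OF assms(1)] finite_short_walks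
    by (metis add_nonneg_nonneg card_0_eq empty_iff less_imp_le less_one not_le)
  finally show ?thesis by simp
qed

lemma card_short_walks_reachable:
  assumes "z \<rightarrow>\<^sup>*\<^bsub>G\<^esub> w"
  shows "\<exists>K d. 0 \<le> d \<and> (\<forall>r\<ge>0. card (short_walks w r) \<le> K * card (short_walks z (r + d)))"
  using assms
proof (induction rule: reachable_induct)
  case base
  show ?case by (intro exI[of _ 1] exI[of _ 0]) simp
next
  case (step u v)
  then obtain a where a: "a \<in> arcs G" "tail G a = u" "head G a = v"
    by (auto simp: arcs_ends_def arc_to_ends_def)
  obtain K d where IH: "0 \<le> d" "\<And>r. 0 \<le> r \<Longrightarrow> card (short_walks u r) \<le> K * card (short_walks z (r + d))"
    using step by blast
  have "card (short_walks v r) \<le> 3 * K * card (short_walks z (r + (len a + d)))" if "0 \<le> r" for r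
  proof -
    have "card (short_walks v r) \<le> 3 * card (short_walks u (r + len a))"
      using card_short_walks_step[OF a(1) that] a by simp
    also have "\<dots> \<le> 3 * (K * card (short_walks z (r + len a + d)))"
      using IH(2)[of "r + len a"] that len_pos[OF a(1)] by (intro mult_left_mono) auto
    finally show ?thesis by (simp add: ac_simps)
  qed
  then show ?case using IH(1) len_pos[OF a(1)]
    by (intro exI[of _ "3 * K"] exI[of _ "len a + d"]) auto
qed

lemma card_reduced_short_le:
  assumes "z \<in> verts G" "\<And>w. w \<in> verts G \<Longrightarrow> z \<rightarrow>\<^sup>*\<^bsub>G\<^esub> w"
  shows "\<exists>K d. 0 \<le> d \<and>
    (\<forall>r\<ge>0. card {p. reduced p \<and> path_length len p \<le> r} \<le> K * card (short_walks z (r + d)))"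
proof -
  have "\<forall>w\<in>verts G. \<exists>K d. 0 \<le> d \<and> (\<forall>r\<ge>0. card (short_walks w r) \<le> K * card (short_walks z (r + d)))"
    using card_short_walks_reachable[OF assms(2)] by blast
  then obtain K d where Kd: "\<And>w. w \<in> verts G \<Longrightarrow> 0 \<le> d w"
      "\<And>w r. w \<in> verts G \<Longrightarrow> 0 \<le> r \<Longrightarrow> card (short_walks w r) \<le> K w * card (short_walks z (r + d w))"
    by metis
  let ?D = "\<Sum>w\<in>verts G. d w"
  have "card {p. reduced p \<and> path_length len p \<le> r} \<le> (\<Sum>w\<in>verts G. K w) * card (short_walks z (r + ?D))"
    if r: "0 \<le> r" for r
  proof -
    have "{p. reduced p \<and> path_length len p \<le> r} \<subseteq> (\<Union>w\<in>verts G. short_walks w r)"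
      using reduced_subset_UN_walks_from Nil_in_short_walks[OF r] assms(1)
      by (fastforce simp: short_walks_def)
    then have "card {p. reduced p \<and> path_length len p \<le> r} \<le> card (\<Union>w\<in>verts G. short_walks w r)"
      by (intro card_mono) (auto simp: finite_short_walks)
    also have "\<dots> \<le> (\<Sum>w\<in>verts G. card (short_walks w r))" by (rule card_UN_le) simp
    also have "\<dots> \<le> (\<Sum>w\<in>verts G. K w * card (short_walks z (r + ?D)))"
    proof (rule sum_mono)
      fix w assume w: "w \<in> verts G"
      have "d w \<le> ?D" using w Kd(1) by (intro member_le_sum) auto
      then have "card (short_walks z (r + d w)) \<le> card (short_walks z (r + ?D))"
        by (intro card_mono finite_short_walks short_walks_mono) simp
      then show "card (short_walks w r) \<le> K w * card (short_walks z (r + ?D))"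
        using Kd(2)[OF w r] by (meson mult_le_mono2 order_trans)
    qed
    finally show ?thesis by (simp add: sum_distrib_right)
  qed
  moreover have "0 \<le> ?D" using Kd(1) by (intro sum_nonneg)
  ultimately show ?thesis by blast
qed

text \<open>For \<open>0 <= t\<close> every counted walk weighs at least
  \<open>exp (- r * t)\<close>, while all of them together weigh at most the finite total.\<close>

lemma card_short_walks_upper:
  assumes "0 \<le> t" "wt len t (Collect reduced) < \<infinity>"
  shows "\<exists>C>0. \<forall>r. card (short_walks z r) \<le> C * exp (t * r)"
proof -
  obtain C where C: "wt len t (Collect reduced) = ennreal C" "0 \<le> C"
    using assms(2) by (cases "wt len t (Collect reduced)") auto
  have "card (short_walks z r) \<le> (C + 1) * exp (t * r)" for r
  proof -
    have "card (short_walks z r) * exp (- r * t) = (\<Sum>p\<in>short_walks z r. exp (- r * t))" by simp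
    also have "\<dots> \<le> (\<Sum>p\<in>short_walks z r. exp (- path_length len p * t))"
      using assms(1) by (intro sum_mono) (auto simp: short_walks_def mult_right_mono)
    also have "\<dots> \<le> C"
    proof -
      have "wt len t (short_walks z r) \<le> wt len t (Collect reduced)"
        by (intro wt_mono) (auto simp: short_walks_def walks_from_def)
      then show ?thesis using C by (simp add: wt_finite_sum[OF finite_short_walks])
    qed
    finally have "card (short_walks z r) * exp (- r * t) \<le> C + 1" by simp
    then show ?thesis by (simp add: exp_minus field_simps)
  qed
  then show ?thesis using C(2) by (intro exI[of _ "C + 1"]) auto
qed

text \<open>Divergence makes \<open>crossing r\<close> weigh at least 1, and each of its walks
  weighs at most \<open>exp (- r * h)\<close>, so there are at least \<open>exp (h * r)\<close> of
  them. Overshoot by one edge (\<open>M\<close>) and change of base point (\<open>K\<close>,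
  \<open>d\<close>) only cost a constant factor.\<close>

lemma card_short_walks_lower:
  assumes "z \<in> verts G" "\<And>w. w \<in> verts G \<Longrightarrow> z \<rightarrow>\<^sup>*\<^bsub>G\<^esub> w"
    and "0 \<le> h" "wt len h (Collect reduced) = \<infinity>"
  shows "\<exists>c>0. \<forall>\<^sub>F r in at_top. c * exp (h * r) \<le> card (short_walks z r)"
proof -
  obtain M where M: "0 < M" "\<And>a. a \<in> arcs G \<Longrightarrow> len a \<le> M" by (rule len_upper_bound) blast
  obtain K d where Kd: "0 \<le> d"
      "\<And>r. 0 \<le> r \<Longrightarrow> card {p. reduced p \<and> path_length len p \<le> r} \<le> K * card (short_walks z (r + d))"
    using card_reduced_short_le[OF assms(1,2)] by blast
  have low: "exp (h * r) \<le> K * card (short_walks z (r + M + d))" if r: "0 < r" for r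
  proof -
    have "\<not> wt len h (crossing r) < 1" using wt_reduced_finite_if_crossing[OF r] assms(4) by force
    then have "1 \<le> (\<Sum>p\<in>crossing r. exp (- path_length len p * h))"
      by (simp add: wt_finite_sum[OF finite_crossing] ennreal_less_one_iff)
    also have "\<dots> \<le> (\<Sum>p\<in>crossing r. exp (- r * h))"
      using assms(3) by (intro sum_mono) (auto simp: crossing_def mult_right_mono)
    also have "\<dots> = card (crossing r) * exp (- r * h)" by simp
    finally have "exp (h * r) \<le> card (crossing r)" by (simp add: exp_minus field_simps)
    also have "card (crossing r) \<le> card {p. reduced p \<and> path_length len p \<le> r + M}"
      using crossing_length_le[OF _ M(2)]
      by (intro card_mono finite_reduced_short) (auto simp: crossing_def)
    also have "\<dots> \<le> K * card (short_walks z (r + M + d))" using Kd(2)[of "r + M"] r M by simp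
    finally show ?thesis by simp
  qed
  \<comment> \<open>\<open>K = 0\<close> would force \<open>exp h <= 0\<close>.\<close>
  have "0 < K" using low[of 1] by (cases K) (auto simp: not_le[symmetric])
  let ?c = "exp (- h * (M + d)) / K"
  have "?c * exp (h * r) \<le> card (short_walks z r)" if "M + d < r" for r
  proof -
    have "?c * exp (h * r) = exp (h * (r - (M + d))) / K" by (simp add: exp_add[symmetric] algebra_simps)
    also have "\<dots> \<le> card (short_walks z r)"
      using low[of "r - (M + d)"] that \<open>0 < K\<close> by (simp add: field_simps)
    finally show ?thesis .
  qed
  then have "\<forall>\<^sub>F r in at_top. ?c * exp (h * r) \<le> card (short_walks z r)"
    using eventually_gt_at_top by (rule eventually_mono[rotated])
  then show ?thesis using \<open>0 < K\<close> by (intro exI[of _ ?c]) auto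
qed

end

section \<open>Volume of balls in the universal cover\<close>

lemma measure_lborel_le_length:
  assumes "S \<subseteq> {0..l::real}" "0 \<le> l"
  shows "measure lborel S \<le> l"
proof (cases "S \<in> sets lborel")
  case True
  then have "measure lborel S \<le> measure lborel {0..l}"
    using assms by (intro measure_mono_fmeasurable) (auto simp: fmeasurable_def)
  then show ?thesis using assms by simp
\<comment> \<open>By convention a non-measurable set has \<open>measure\<close> 0, so the bound
  holds for it too.\<close>
qed (use assms in \<open>simp add: measure_notin_sets\<close>)

context fin_metric_graph
begin

lemma awalk_reduced_iff:
  assumes "z \<in> verts G"
  shows "awalk z p w \<and> no_backtracking arev p \<longleftrightarrow>
    p \<in> walks_from z \<and> w = (if p = [] then z else head G (last p))"
  using assms awalk_no_backtracking_iff[of p z w]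
  by (cases "p = []") (auto simp: walks_from_def awalk_Nil_iff no_backtracking_def)

lemma verts_universal_cover:
  "z \<in> verts G \<Longrightarrow> verts (universal_cover G arev z) = walks_from z"
  by (auto simp: universal_cover_def awalk_reduced_iff)

lemma arcs_universal_cover:
  "z \<in> verts G \<Longrightarrow> arcs (universal_cover G arev z) =
    {(p, a). p \<in> walks_from z \<and> a \<in> arcs G \<and> tail G a = (if p = [] then z else head G (last p))}"
  using awalk_reduced_iff[of z _ "tail G _"] unfolding universal_cover_def by auto

lemma tail_universal_cover: "tail (universal_cover G arev z) (p, a) = p"
  by (simp add: universal_cover_def)

lemma head_universal_cover:
  "head (universal_cover G arev z) (p, a) = (if p \<noteq> [] \<and> a = arev (last p) then butlast p else p @ [a])"
  by (simp add: universal_cover_def)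

lemma last_in_arcs: "reduced p \<Longrightarrow> p \<noteq> [] \<Longrightarrow> last p \<in> arcs G"
  by (auto simp: reduced_def)

lemma path_length_head_universal_cover:
  assumes "z \<in> verts G" "(p, a) \<in> arcs (universal_cover G arev z)"
  shows "path_length len (head (universal_cover G arev z) (p, a)) \<le> path_length len p + len a"
    "path_length len p \<le> path_length len (head (universal_cover G arev z) (p, a)) + len a"
proof -
  have a: "a \<in> arcs G" and p: "reduced p" using assms by (auto simp: arcs_universal_cover walks_from_def)
  then show "path_length len (head (universal_cover G arev z) (p, a)) \<le> path_length len p + len a"
    "path_length len p \<le> path_length len (head (universal_cover G arev z) (p, a)) + len a"
    using len_pos[OF a] len_rev[OF last_in_arcs[OF p]] path_length_snoc_butlast[of p len]
    by (auto simp: head_universal_cover)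
qed

text \<open>Since edges change \<^const>\<open>path_length\<close> by at most their own length, a reduced walk is a
  geodesic of the universal cover.\<close>

lemma \<mu>_universal_cover:
  assumes z: "z \<in> verts G" and p: "p \<in> walks_from z"
  shows "wf_digraph.\<mu> (universal_cover G arev z) (cover_len len) [] p = ereal (path_length len p)"
proof -
  interpret T: wf_digraph "universal_cover G arev z" by (rule wf_digraph_universal_cover)
  \<comment> \<open>The walk in the cover through all prefixes of \<open>p\<close> realizes the
    claimed distance.\<close>
  have "\<exists>es. T.awalk [] es p \<and> T.awalk_cost (cover_len len) es = path_length len p"
    using p
  proof (induction p rule: rev_induct)
    case Nil
    then show ?case by (intro exI[of _ "[]"]) (simp add: T.awalk_Nil_iff verts_universal_cover[OF z])
  next
    case (snoc a p)
    then have p: "p \<in> walks_from z" and pa: "reduced (p @ [a])" "a \<in> arcs G"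
      by (auto simp: walks_from_def reduced_append reduced_Cons hd_append split: if_splits)
    then obtain es where es: "T.awalk [] es p" "T.awalk_cost (cover_len len) es = path_length len p"
      using snoc by blast
    have arc: "(p, a) \<in> arcs (universal_cover G arev z)"
      using p pa snoc.prems by (auto simp: arcs_universal_cover[OF z] walks_from_def reduced_append)
    have "head (universal_cover G arev z) (p, a) = p @ [a]"
      using pa by (auto simp: head_universal_cover reduced_append)
    then have "T.awalk p [(p, a)] (p @ [a])"
      using T.arc_implies_awalk[OF arc] by (simp add: tail_universal_cover)
    with es show ?case
      by (intro exI[of _ "es @ [(p, a)]"]) (auto simp: T.awalk_cost_append cover_len_def intro: T.awalk_appendI)
  qed
  then obtain es where es: "T.awalk [] es p" "T.awalk_cost (cover_len len) es = path_length len p" by blast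
  have "path_length len v \<le> path_length len u + T.awalk_cost (cover_len len) es" if "T.awalk u es v" for u v es
    using that
  proof (induction es arbitrary: u)
    case (Cons ea es)
    obtain q a where ea: "ea = (q, a)" by (cases ea)
    from Cons.prems have *: "(q, a) \<in> arcs (universal_cover G arev z)" "q = u"
        "T.awalk (head (universal_cover G arev z) (q, a)) es v"
      by (auto simp: T.awalk_Cons_iff ea tail_universal_cover)
    then show ?case
      using Cons.IH[OF *(3)] path_length_head_universal_cover(1)[OF z *(1)] by (simp add: ea cover_len_def)
  qed (simp add: T.awalk_Nil_iff)
  from this[of "[]"] have "ereal (path_length len p) \<le> T.\<mu> (cover_len len) [] p"
    unfolding T.\<mu>_def by (intro INF_greatest) auto
  moreover have "T.\<mu> (cover_len len) [] p \<le> ereal (path_length len p)"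
    unfolding T.\<mu>_def es(2)[symmetric] using es(1) by (intro INF_lower) simp
  ultimately show ?thesis by (rule antisym[rotated])
qed

context
  fixes z assumes z: "z \<in> verts G"
begin

lemma edge_part_universal_cover:
  assumes "(p, a) \<in> arcs (universal_cover G arev z)"
  shows "edge_part (universal_cover G arev z) (cover_len len) [] r (p, a) =
    {s \<in> {0..len a}. path_length len p + s \<le> r \<or>
      path_length len (head (universal_cover G arev z) (p, a)) + (len a - s) \<le> r}"
proof -
  interpret T: wf_digraph "universal_cover G arev z" by (rule wf_digraph_universal_cover)
  have "p \<in> walks_from z" "head (universal_cover G arev z) (p, a) \<in> walks_from z"
    using T.tail_in_verts[OF assms] T.head_in_verts[OF assms]
    by (auto simp: verts_universal_cover[OF z] tail_universal_cover)
  moreover have "cover_len len (p, a) = len a" by (simp add: cover_len_def)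
  ultimately show ?thesis
    by (simp add: edge_part_def \<mu>_universal_cover[OF z] tail_universal_cover)
qed

text \<open>For a radius enlarged by the maximal edge length, this is a finite set containing every
  arc that meets the ball.\<close>

definition near_arcs :: "real \<Rightarrow> ('b list \<times> 'b) set" where
  "near_arcs r = {(p, a) \<in> arcs (universal_cover G arev z). path_length len p \<le> r}"

lemma near_arcs_subset: "near_arcs r \<subseteq> short_walks z r \<times> arcs G"
  by (auto simp: near_arcs_def arcs_universal_cover[OF z] short_walks_def)

lemma finite_near_arcs: "finite (near_arcs r)"
  by (rule finite_subset[OF near_arcs_subset]) (auto simp: finite_short_walks)

lemma vol_ball_universal_cover:
  assumes M: "\<And>a. a \<in> arcs G \<Longrightarrow> len a \<le> M"
  shows "vol_ball (universal_cover G arev z) (cover_len len) [] r =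
    (\<Sum>a\<in>near_arcs (r + M). measure lborel (edge_part (universal_cover G arev z) (cover_len len) [] r a)) / 2"
proof -
  let ?E = "edge_part (universal_cover G arev z) (cover_len len) [] r"
  have "(\<Sum>\<^sub>\<infinity>a\<in>arcs (universal_cover G arev z). measure lborel (?E a))
    = (\<Sum>\<^sub>\<infinity>a\<in>near_arcs (r + M). measure lborel (?E a))"
  proof (rule infsum_cong_neutral)
    fix b assume b: "b \<in> arcs (universal_cover G arev z) - near_arcs (r + M)"
    obtain p a where pa: "b = (p, a)" by (cases b)
    have arc: "(p, a) \<in> arcs (universal_cover G arev z)" and far: "r + M < path_length len p"
      using b by (auto simp: pa near_arcs_def)
    have "a \<in> arcs G" using arc by (simp add: arcs_universal_cover[OF z])
    \<comment> \<open>The tail is farther than \<open>r + M\<close>, so the head is still farther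
      than \<open>r\<close>, and the ball reaches the arc from neither end.\<close>
    then have "?E (p, a) = {}"
      using far path_length_head_universal_cover(2)[OF z arc] M[of a] len_pos[of a]
      by (auto simp: edge_part_universal_cover[OF arc])
    then show "measure lborel (?E b) = 0" by (simp add: pa)
  qed (auto simp: near_arcs_def)
  then show ?thesis by (simp add: vol_ball_def finite_near_arcs)
qed

text \<open>At most \<open>card (arcs G)\<close> arcs start at each vertex of the cover, and each
  contributes at most the maximal edge length.\<close>

lemma vol_ball_universal_cover_le:
  "\<exists>C>0::real. \<exists>M. \<forall>r. vol_ball (universal_cover G arev z) (cover_len len) [] r \<le> C * real (card (short_walks z (r + M)))"
proof -
  obtain M where M: "0 < M" "\<And>a. a \<in> arcs G \<Longrightarrow> len a \<le> M" by (rule len_upper_bound) blast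
  let ?C = "M * card (arcs G)"
  have *: "vol_ball (universal_cover G arev z) (cover_len len) [] r \<le> (?C + 1) * card (short_walks z (r + M))" for r
  proof -
    have "(\<Sum>b\<in>near_arcs (r + M). measure lborel (edge_part (universal_cover G arev z) (cover_len len) [] r b))
        \<le> (\<Sum>b\<in>near_arcs (r + M). M)"
    proof (rule sum_mono)
      fix b assume "b \<in> near_arcs (r + M)"
      then obtain p a where b: "b = (p, a)" and a: "a \<in> arcs G" using near_arcs_subset by blast
      have "measure lborel (edge_part (universal_cover G arev z) (cover_len len) [] r b) \<le> len a"
        using len_pos[OF a] by (intro measure_lborel_le_length) (auto simp: b edge_part_def cover_len_def)
      then show "measure lborel (edge_part (universal_cover G arev z) (cover_len len) [] r b) \<le> M"
        using M(2)[OF a] by linarith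
    qed
    also have "\<dots> = card (near_arcs (r + M)) * M" by simp
    also have "\<dots> \<le> (card (short_walks z (r + M)) * card (arcs G)) * M"
    proof (intro mult_right_mono of_nat_mono)
      show "card (near_arcs (r + M)) \<le> card (short_walks z (r + M)) * card (arcs G)"
        using card_mono[OF _ near_arcs_subset] by (simp add: card_cartesian_product finite_short_walks)
    qed (use M in simp)
    finally have "2 * vol_ball (universal_cover G arev z) (cover_len len) [] r \<le> ?C * real (card (short_walks z (r + M)))"
      by (simp add: vol_ball_universal_cover[OF M(2)] ac_simps)
    moreover have "0 \<le> ?C * real (card (short_walks z (r + M)))" using M(1) by simp
    ultimately have "vol_ball (universal_cover G arev z) (cover_len len) [] r \<le> ?C * real (card (short_walks z (r + M)))"
      by linarith
    then show ?thesis by (simp add: distrib_right)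
  qed
  have "0 < ?C + 1" using M(1) by (intro add_nonneg_pos) auto
  then show ?thesis using * by (intro exI[of _ "?C + 1"] conjI exI[of _ M] allI)
qed

text \<open>The arc leading back along the last edge of a short walk \<open>p\<close> lies entirely
  in the ball, because \<open>p\<close> does and the other end is closer to the base point. Distinct
  \<open>p\<close> give distinct arcs; the 1 subtracted accounts for the empty walk, which has no
  last edge.\<close>

lemma vol_ball_universal_cover_ge:
  "\<exists>c>0::real. \<forall>r. c * real (card (short_walks z r) - 1) \<le> vol_ball (universal_cover G arev z) (cover_len len) [] r"
proof -
  obtain M where M: "0 < M" "\<And>a. a \<in> arcs G \<Longrightarrow> len a \<le> M" by (rule len_upper_bound) blast
  obtain m where m: "0 < m" "\<And>a. a \<in> arcs G \<Longrightarrow> m \<le> len a" by (rule len_lower_bound) blast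
  have "m / 2 * real (card (short_walks z r) - 1) \<le> vol_ball (universal_cover G arev z) (cover_len len) [] r" for r
  proof -
    let ?E = "edge_part (universal_cover G arev z) (cover_len len) [] r"
    let ?f = "\<lambda>p. (p, arev (last p))"
    let ?S = "short_walks z r - {[]}"
    have last_arc: "(p, arev (last p)) \<in> near_arcs (r + M) \<and> m \<le> measure lborel (?E (p, arev (last p)))" if "p \<in> ?S" for p
    proof -
      have p: "reduced p" "p \<noteq> []" "path_length len p \<le> r" "p \<in> walks_from z"
        using that by (auto simp: short_walks_def walks_from_def)
      have l: "last p \<in> arcs G" by (rule last_in_arcs) fact+
      have arc: "(p, arev (last p)) \<in> arcs (universal_cover G arev z)"
        using p l by (auto simp: arcs_universal_cover[OF z])
      have "?E (p, arev (last p)) = {0..len (last p)}"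
        unfolding edge_part_universal_cover[OF arc]
        using p path_length_snoc_butlast[OF p(2), of len] by (auto simp: head_universal_cover len_rev[OF l])
      then show ?thesis using arc p M(1) m(2)[OF l] len_pos[OF l] by (simp add: near_arcs_def)
    qed
    have "m * real (card (short_walks z r) - 1) \<le> m * real (card ?S)"
      using m(1) by (intro mult_left_mono of_nat_mono) (auto simp: card_Diff_singleton_if)
    also have "\<dots> = (\<Sum>p\<in>?S. m)" by simp
    also have "\<dots> \<le> (\<Sum>p\<in>?S. measure lborel (?E (?f p)))" using last_arc by (intro sum_mono) auto
    also have "\<dots> = (\<Sum>b\<in>?f ` ?S. measure lborel (?E b))"
      by (subst sum.reindex) (auto simp: inj_on_def)
    also have "\<dots> \<le> (\<Sum>b\<in>near_arcs (r + M). measure lborel (?E b))"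
      using last_arc by (intro sum_mono2 finite_near_arcs) auto
    finally show ?thesis by (simp add: vol_ball_universal_cover[OF M(2)])
  qed
  then show ?thesis using m(1) by (intro exI[of _ "m / 2"]) auto
qed

end

text \<open>The volume and the number of short walks agree up to constants and a shift of the
  radius, so connectedness gives the same limit \<open>h\<close> at every base point and the maximum
  is taken over a singleton.\<close>

theorem volume_entropy_eqI:
  assumes conn: "\<And>z w. z \<in> verts G \<Longrightarrow> w \<in> verts G \<Longrightarrow> z \<rightarrow>\<^sup>*\<^bsub>G\<^esub> w" and ne: "verts G \<noteq> {}"
    and h: "0 \<le> h" "wt len h (Collect reduced) = \<infinity>"
    and above: "\<And>t. h < t \<Longrightarrow> wt len t (Collect reduced) < \<infinity>"
  shows "volume_entropy G arev len = h"
proof -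
  have "Lim at_top (\<lambda>r. ln (vol_ball (universal_cover G arev z) (cover_len len) [] r) / r) = h"
    if z: "z \<in> verts G" for z
  proof (rule tendsto_Lim)
    let ?V = "vol_ball (universal_cover G arev z) (cover_len len) []"
    \<comment> \<open>Divergence yields a nonempty walk \<open>p\<close> from \<open>z\<close>. From
      radius \<open>path_length len p\<close> on there are at least two short walks, so subtracting
      1 costs at most half of the count.\<close>
    have "\<not> wt len h (walks_from z) < \<infinity>"
      using wt_reduced_finite_if_walks_from[OF z conn[OF z], of h] h(2) by auto
    then have "\<not> wt len h (walks_from z) \<le> wt len h {[]}"
      using le_less_trans[OF _ wt_finite[of "{[]}" len h]] by blast
    then have "\<not> walks_from z \<subseteq> {[]}" using wt_mono by blast
    then obtain p where p: "p \<in> walks_from z" "p \<noteq> []" by (auto simp: subset_iff)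
    obtain c where c: "0 < c" "\<And>r. c * real (card (short_walks z r) - 1) \<le> ?V r"
      using vol_ball_universal_cover_ge[OF z] by blast
    obtain c' where c': "0 < c'" "\<forall>\<^sub>F r in at_top. c' * exp (h * r) \<le> card (short_walks z r)"
      using card_short_walks_lower[OF z conn[OF z] h] by blast
    show "((\<lambda>r. ln (?V r) / r) \<longlongrightarrow> h) at_top"
    proof (rule tendsto_ln_div_at_top)
      show "0 < c * c' / 2" using c(1) c'(1) by simp
      show "\<forall>\<^sub>F r in at_top. c * c' / 2 * exp (h * r) \<le> ?V r"
        using c'(2) eventually_ge_at_top[of "path_length len p"]
      proof eventually_elim
        case (elim r)
        have "{[], p} \<subseteq> short_walks z r"
          using p elim(2) path_length_nonneg[of p] by (auto simp: short_walks_def walks_from_def)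
        then have "card {[], p} \<le> card (short_walks z r)" by (intro card_mono finite_short_walks)
        then have "card (short_walks z r) / 2 \<le> real (card (short_walks z r) - 1)" using p(2) by simp
        then have "c * (c' * exp (h * r) / 2) \<le> c * real (card (short_walks z r) - 1)"
          using c(1) elim(1) by (intro mult_left_mono) auto
        then show ?case using c(2)[of r] by simp
      qed
      fix t assume t: "h < t"
      obtain C M where C: "0 < C" "\<And>r. ?V r \<le> C * real (card (short_walks z (r + M)))"
        using vol_ball_universal_cover_le[OF z] by blast
      obtain D where D: "0 < D" "\<And>r. card (short_walks z r) \<le> D * exp (t * r)"
        using card_short_walks_upper[OF _ above[OF t]] t h(1) by force
      have "?V r \<le> C * D * exp (t * M) * exp (t * r)" for r
      proof -
        have "?V r \<le> C * (D * exp (t * (r + M)))"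
          using C(2)[of r] D(2)[of "r + M"] C(1) by (meson mult_left_mono less_imp_le order_trans)
        then show ?thesis by (simp add: exp_add distrib_left ac_simps)
      qed
      then show "\<exists>C>0. \<forall>\<^sub>F r in at_top. ?V r \<le> C * exp (t * r)"
        using C(1) D(1) by (intro exI[of _ "C * D * exp (t * M)"]) auto
    qed
  qed simp
  then have "(\<lambda>z. Lim at_top (\<lambda>r. ln (vol_ball (universal_cover G arev z) (cover_len len) [] r) / r)) ` verts G = {h}"
    using ne by auto
  then show ?thesis by (simp add: volume_entropy_def)
qed

end

section \<open>Cutting walks at the new edge\<close>

context fin_metric_graph
begin

lemma reduced_rev_map_arev: "reduced p \<Longrightarrow> reduced (rev (map arev p))"
proof (induction p)
  case (Cons a p)
  then show ?case
    by (cases p) (auto simp: reduced_Cons reduced_append last_rev hd_map arev_eq_iff)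
qed simp

lemma path_length_rev_map_arev:
  "set p \<subseteq> arcs G \<Longrightarrow> path_length len (rev (map arev p)) = path_length len p"
  by (induction p) (auto simp: len_rev)

text \<open>Reversing a path preserves its length and the absence of backtracking, and is an
  involution.\<close>

lemma wt_nb_paths_commute: "wt len t (nb_paths G arev z w) = wt len t (nb_paths G arev w z)"
proof -
  have "wt len t (nb_paths G arev w z) \<le> wt len t (nb_paths G arev z w)" for z w
  proof -
    have "nb_paths G arev w z \<subseteq> (\<lambda>p. rev (map arev p)) ` nb_paths G arev z w"
    proof
      fix p assume p: "p \<in> nb_paths G arev w z"
      then have "hd p \<in> arcs G" "last p \<in> arcs G" by (auto simp: nb_paths_eq reduced_def)
      then have "rev (map arev p) \<in> nb_paths G arev z w"
        using p reduced_rev_map_arev[of p] by (auto simp: nb_paths_eq hd_rev last_rev hd_map last_map)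
      moreover have "p = rev (map arev (rev (map arev p)))" by (simp add: rev_map)
      ultimately show "p \<in> (\<lambda>p. rev (map arev p)) ` nb_paths G arev z w" by blast
    qed
    then have "wt len t (nb_paths G arev w z) \<le> wt len t ((\<lambda>p. rev (map arev p)) ` nb_paths G arev z w)"
      by (rule wt_mono)
    also have "\<dots> \<le> wt len t (nb_paths G arev z w)"
      by (intro wt_image_le path_length_rev_map_arev) (auto simp: nb_paths_eq reduced_def)
    finally show ?thesis .
  qed
  then show ?thesis by (intro antisym)
qed

text \<open>Mirror image of \<open>walks_from_step\<close> at the other end: a final edge
  \<open>a\<close> is deleted, and otherwise \<open>arev a\<close> can be appended. Deletion may
  leave the empty word, which \<open>nb_paths\<close> excludes; hence the added
  \<open>{[]}\<close>.\<close>

lemma nb_paths_step: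
  assumes "a \<in> arcs G"
  shows "nb_paths G arev z (head G a) \<subseteq> (\<lambda>p. p @ [a]) ` ({[]} \<union> nb_paths G arev z (tail G a)) \<union>
    {p. p @ [arev a] \<in> nb_paths G arev z (tail G a)}"
proof
  fix p assume p: "p \<in> nb_paths G arev z (head G a)"
  then obtain q b where q: "p = q @ [b]" by (cases p rule: rev_cases) (auto simp: nb_paths_eq)
  show "p \<in> (\<lambda>p. p @ [a]) ` ({[]} \<union> nb_paths G arev z (tail G a)) \<union>
    {p. p @ [arev a] \<in> nb_paths G arev z (tail G a)}"
  proof (cases "b = a")
    case True
    then have "q \<in> {[]} \<union> nb_paths G arev z (tail G a)"
      using p by (auto simp: q nb_paths_eq reduced_append)
    then show ?thesis using True q by blast
  next
    case False
    then have "p @ [arev a] \<in> nb_paths G arev z (tail G a)"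
      using p assms by (auto simp: q nb_paths_eq reduced_append reduced_Cons arev_eq_iff hd_append)
    then show ?thesis by blast
  qed
qed

lemma wt_nb_paths_reachable:
  assumes "u \<rightarrow>\<^sup>*\<^bsub>G\<^esub> v" "wt len t (nb_paths G arev z u) < \<infinity>"
  shows "wt len t (nb_paths G arev z v) < \<infinity>"
  using assms
proof (induction rule: reachable_induct)
  case (step u v)
  then obtain a where a: "a \<in> arcs G" "tail G a = u" "head G a = v"
    by (auto simp: arcs_ends_def arc_to_ends_def)
  let ?P = "nb_paths G arev z u"
  let ?A = "(\<lambda>p. p @ [a]) ` ({[]} \<union> ?P)" and ?B = "{p. p @ [arev a] \<in> ?P}"
  have IH: "wt len t ?P < \<infinity>" using step by blast
  have "wt len t ({[]} \<union> ?P) \<le> wt len t {[]} + wt len t ?P" by (rule wt_Un_le)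
  also have "\<dots> < \<infinity>" using IH by simp
  finally have A: "wt len t ?A < \<infinity>"
    unfolding wt_snoc_image by (simp add: ennreal_mult_less_top)
  have "ennreal (exp (- len (arev a) * t)) * wt len t ?B \<le> wt len t ?P"
    unfolding wt_snoc_image[symmetric] by (intro wt_mono) auto
  also note IH
  finally have B: "wt len t ?B < \<infinity>" by (auto simp: ennreal_mult_less_top ennreal_eq_0_iff)
  have "wt len t (nb_paths G arev z v) \<le> wt len t (?A \<union> ?B)"
    using nb_paths_step[OF a(1), of z] a by (intro wt_mono) auto
  also have "\<dots> \<le> wt len t ?A + wt len t ?B" by (rule wt_Un_le)
  also have "\<dots> < \<infinity>" using A B by simp
  finally show ?case .
qed simp

lemma nb_paths_reachable: "p \<in> nb_paths G arev z w \<Longrightarrow> z \<rightarrow>\<^sup>*\<^bsub>G\<^esub> w"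
  by (auto simp: nb_paths_def intro: reachable_awalkI)

text \<open>Walks are sorted by their end vertex. Only ends reachable from \<open>z\<close>
  contribute, and moving the end along edges preserves finiteness.\<close>

lemma wt_walks_from_finite_if_closed:
  assumes "z \<in> verts G" "wt len t (nb_paths G arev z z) < \<infinity>"
  shows "wt len t (walks_from z) < \<infinity>"
proof -
  have "walks_from z \<subseteq> {[]} \<union> (\<Union>w\<in>verts G. nb_paths G arev z w)"
    using last_in_arcs by (fastforce simp: walks_from_def nb_paths_eq)
  then have "wt len t (walks_from z) \<le> wt len t ({[]} \<union> (\<Union>w\<in>verts G. nb_paths G arev z w))"
    by (rule wt_mono)
  also have "\<dots> \<le> wt len t {[]} + wt len t (\<Union>w\<in>verts G. nb_paths G arev z w)" by (rule wt_Un_le)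
  also have "\<dots> \<le> wt len t {[]} + (\<Sum>w\<in>verts G. wt len t (nb_paths G arev z w))"
    by (intro add_left_mono wt_UN_le) simp
  also have "\<dots> < \<infinity>"
  proof -
    have "wt len t (nb_paths G arev z w) < \<infinity>" for w
    proof (cases "nb_paths G arev z w = {}")
      case False
      then show ?thesis using nb_paths_reachable wt_nb_paths_reachable[OF _ assms(2)] by blast
    qed simp
    then show ?thesis by simp
  qed
  finally show ?thesis .
qed

text \<open>Moving the end point \<open>w\<close> back to \<open>z\<close> gives the closed paths at
  \<open>z\<close>; reversing first gives those at \<open>w\<close>.\<close>

lemma wt_closed_finite_if_connecting:
  assumes "nb_paths G arev z w \<noteq> {}" "wt len t (nb_paths G arev z w) < \<infinity>"
  shows "wt len t (nb_paths G arev z z) < \<infinity>" "wt len t (nb_paths G arev w w) < \<infinity>"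
proof -
  have "z \<rightarrow>\<^sup>*\<^bsub>G\<^esub> w" using assms(1) nb_paths_reachable by blast
  moreover have "w \<rightarrow>\<^sup>*\<^bsub>G\<^esub> z" using calculation by (rule symmetric_reachable')
  ultimately show "wt len t (nb_paths G arev z z) < \<infinity>" "wt len t (nb_paths G arev w w) < \<infinity>"
    using wt_nb_paths_reachable assms(2) wt_nb_paths_commute by metis+
qed

end

section \<open>The extended graph and the continuations after a new edge\<close>

locale attached_edge = fin_metric_graph G arev len
  for G :: "('a, 'b) pre_digraph" and arev len +
  fixes x y :: 'a and e e' :: 'b and l0 :: real
  assumes x: "x \<in> verts G" and y: "y \<in> verts G" and xy: "x \<noteq> y"
    and e: "e \<notin> arcs G" and e': "e' \<notin> arcs G" and ee': "e \<noteq> e'" and l0: "0 < l0"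
begin

definition G' where "G' = attach_edge G x y e e'"
definition arev' where "arev' = arev(e := e', e' := e)"
definition len' where "len' = len(e := l0, e' := l0)"

sublocale A: fin_metric_graph G' arev' len'
  unfolding G'_def arev'_def len'_def
  by (rule fin_metric_graph_attach_edge) (use x y e e' ee' l0 in auto)

lemma attach_simps [simp]:
  "tail G' e = x" "tail G' e' = y" "head G' e = y" "head G' e' = x"
  "arcs G' = arcs G \<union> {e, e'}" "verts G' = verts G"
  "arev' e = e'" "arev' e' = e" "len' e = l0" "len' e' = l0"
  using ee' by (auto simp: G'_def arev'_def len'_def attach_edge_def)

lemma attach_old [simp]:
  assumes "a \<in> arcs G"
  shows "tail G' a = tail G a" "head G' a = head G a" "arev' a = arev a" "len' a = len a"
  using assms e e' by (auto simp: G'_def arev'_def len'_def attach_edge_def)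

lemma old_neq [simp]: "a \<in> arcs G \<Longrightarrow> a \<noteq> e" "a \<in> arcs G \<Longrightarrow> a \<noteq> e'"
  using e e' by auto

lemma reduced_attach_iff:
  assumes "set p \<subseteq> arcs G"
  shows "A.reduced p \<longleftrightarrow> reduced p"
  using assms
proof (induction p)
  case (Cons a p)
  then show ?case by (cases p) (auto simp: A.reduced_Cons reduced_Cons)
qed simp

lemma path_length_attach: "set p \<subseteq> arcs G \<Longrightarrow> path_length len' p = path_length len p"
  by (induction p) auto

text \<open>The part before the first new edge is recovered by \<open>takeWhile\<close>. This
  uniqueness makes the cuts injective and the cases disjoint.\<close>

lemma first_new_edge_unique:
  assumes "p @ b # q = p' @ b' # q'" "set p \<subseteq> arcs G" "set p' \<subseteq> arcs G" "b \<notin> arcs G" "b' \<notin> arcs G"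
  shows "p = p' \<and> b = b' \<and> q = q'"
proof -
  have *: "takeWhile (\<lambda>a. a \<in> arcs G) (r @ c # s) = r" if "set r \<subseteq> arcs G" "c \<notin> arcs G" for r c s
    using that by (subst takeWhile_append2) auto
  have "p = p'"
    using arg_cong[OF assms(1), of "takeWhile (\<lambda>a. a \<in> arcs G)"] assms(2-5) by (simp add: *)
  then show ?thesis using assms(1) by simp
qed

text \<open>The weights of \<open>cont e\<close> and \<open>cont e'\<close> are the unknowns
  \<open>u\<close> and \<open>v\<close> of the linear system.\<close>

definition cont :: "'b \<Rightarrow> 'b list set" where
  "cont b = {p. A.reduced (b # p)}"

lemma set_nb_paths: "p \<in> nb_paths G arev z w \<Longrightarrow> set p \<subseteq> arcs G"
  by (auto simp: nb_paths_eq reduced_def)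

text \<open>A nonempty excursion inside the old graph, then the new edge \<open>b\<close>, then a
  remainder from \<open>Q\<close>. The set \<open>Q\<close> is a parameter so that truncated
  remainders are covered too.\<close>

definition next_block :: "'a \<Rightarrow> 'a \<Rightarrow> 'b \<Rightarrow> 'b list set \<Rightarrow> 'b list set" where
  "next_block z w b Q = (\<lambda>(p, q). p @ q) ` (nb_paths G arev z w \<times> (#) b ` Q)"

lemma next_blockE:
  assumes "p \<in> next_block z w b Q"
  obtains q s where "p = q @ b # s" "set q \<subseteq> arcs G"
  using assms set_nb_paths by (auto simp: next_block_def)

lemma wt_next_block:
  assumes "b = e \<or> b = e'"
  shows "wt len' t (next_block z w b Q) =
    wt len t (nb_paths G arev z w) * (ennreal (exp (- l0 * t)) * wt len' t Q)"
proof -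
  have b: "b \<notin> arcs G" "len' b = l0" using assms e e' by auto
  have "inj_on (\<lambda>(p, q). p @ q) (nb_paths G arev z w \<times> (#) b ` Q)"
  proof (rule inj_onI, clarify)
    fix p q p' q'
    assume "p \<in> nb_paths G arev z w" "p' \<in> nb_paths G arev z w" "p @ b # q = p' @ b # q'"
    then show "p = p' \<and> b # q = b # q'"
      using first_new_edge_unique[of p b q p' b q'] set_nb_paths b(1) by simp
  qed
  then have "wt len' t (next_block z w b Q) = wt len' t (nb_paths G arev z w) * wt len' t ((#) b ` Q)"
    unfolding next_block_def by (rule wt_concat)
  also have "wt len' t (nb_paths G arev z w) = wt len t (nb_paths G arev z w)"
    by (rule wt_cong_length) (use path_length_attach set_nb_paths in blast)
  finally show ?thesis unfolding wt_Cons_image b .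
qed

text \<open>A continuation is cut at its next new edge: there is none, or it is \<open>b\<close>
  again, or it is the reverse of \<open>b\<close>.\<close>

lemma cont_decomp:
  assumes b: "b = e \<or> b = e'"
  shows "cont b = walks_from (head G' b) \<union> next_block (head G' b) (tail G' b) b (cont b) \<union>
    next_block (head G' b) (head G' b) (arev' b) (cont (arev' b))"
    (is "_ = ?W \<union> ?B \<union> ?C")
proof (intro antisym subsetI)
  fix p assume p: "p \<in> cont b"
  show "p \<in> ?W \<union> ?B \<union> ?C"
  proof (cases "set p \<subseteq> arcs G")
    case True
    have "p \<noteq> [] \<Longrightarrow> hd p \<in> arcs G" using True by auto
    then have "p \<in> ?W" using p reduced_attach_iff[OF True] by (auto simp: cont_def walks_from_def A.reduced_Cons)
    then show ?thesis by simp
  next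
    case False
    then obtain q c s where p_eq: "p = q @ c # s" and c: "c \<notin> arcs G" and q: "set q \<subseteq> arcs G"
      using split_list_first_prop[of p "\<lambda>a. a \<notin> arcs G"] by blast
    have red: "A.reduced (b # q @ c # s)" using p by (simp add: cont_def p_eq)
    then have "c \<in> arcs G'" by (auto simp: A.reduced_def)
    with c have c: "c = e \<or> c = e'" by auto
    \<comment> \<open>Two new edges are never consecutive: \<open>x\<close> and \<open>y\<close> are
      distinct, so \<open>b\<close> cannot follow itself, and its reverse would be
      backtracking.\<close>
    have "q \<noteq> []"
    proof
      assume "q = []"
      then have "head G' b = tail G' c" "c \<noteq> arev' b" using red by (auto simp: A.reduced_Cons)
      then show False using b c xy ee' by auto
    qed
    then have "hd q \<in> arcs G" "last q \<in> arcs G" using q by auto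
    moreover have "reduced q" using red reduced_attach_iff[OF q] by (auto simp: A.reduced_Cons A.reduced_append)
    ultimately have "q \<in> nb_paths G arev (head G' b) (tail G' c)" "s \<in> cont c"
      using red \<open>q \<noteq> []\<close> by (auto simp: A.reduced_Cons A.reduced_append nb_paths_eq cont_def)
    then have "p \<in> next_block (head G' b) (tail G' c) c (cont c)"
      unfolding next_block_def p_eq by force
    then show ?thesis using b c ee' by auto
  qed
next
  have blocks: "p \<in> cont b"
    if block: "p \<in> next_block (head G' b) (tail G' c) c (cont c)" and c: "c = e \<or> c = e'" for p c
  proof -
    obtain q s where p: "p = q @ c # s" and q: "q \<in> nb_paths G arev (head G' b) (tail G' c)"
        and s: "A.reduced (c # s)"
      using block by (auto simp: next_block_def cont_def)
    have ne: "q \<noteq> []" and ends: "tail G (hd q) = head G' b" "head G (last q) = tail G' c"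
      using q by (auto simp: nb_paths_eq)
    have old: "hd q \<in> arcs G" "last q \<in> arcs G" using set_nb_paths[OF q] ne by auto
    have red: "A.reduced q"
      using q reduced_attach_iff[OF set_nb_paths[OF q]] by (simp add: nb_paths_eq)
    \<comment> \<open>Reverses of old edges are old and reverses of new edges are new, so no
      backtracking arises where old and new edges meet.\<close>
    have "arev (last q) \<in> arcs G" using old by simp
    then have turn: "hd q \<noteq> arev' b" "c \<noteq> arev' (last q)" using old b c e e' by auto
    have "A.reduced (q @ c # s)"
      using red s ne ends old turn by (simp add: A.reduced_append)
    then show ?thesis using ne ends old turn b by (auto simp: p cont_def A.reduced_Cons)
  qed
  fix p assume "p \<in> ?W \<union> ?B \<union> ?C"
  then consider "p \<in> ?W" | "p \<in> ?B" | "p \<in> ?C" by (elim UnE)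
  then show "p \<in> cont b"
  proof cases
    case 1
    then have "A.reduced p"
      using reduced_attach_iff[of p] by (simp add: walks_from_def reduced_def)
    moreover have "hd p \<in> arcs G" "tail G (hd p) = head G' b" if "p \<noteq> []"
      using 1 that hd_in_set[OF that] by (auto simp: walks_from_def reduced_def)
    moreover have "hd p \<noteq> arev' b" if "hd p \<in> arcs G" using that b e e' by auto
    ultimately show ?thesis using b by (auto simp: cont_def A.reduced_Cons)
  next
    case 2
    then show ?thesis by (rule blocks) (rule b)
  next
    case 3
    have "head G' b = tail G' (arev' b)" "arev' b = e \<or> arev' b = e'" using b by auto
    with 3 show ?thesis by (intro blocks[of p "arev' b"]) simp_all
  qed
qed

lemma wt_cont:
  assumes b: "b = e \<or> b = e'"
  shows "wt len' t (cont b) = wt len t (walks_from (head G' b)) +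
    wt len t (nb_paths G arev (head G' b) (tail G' b)) * (ennreal (exp (- l0 * t)) * wt len' t (cont b)) +
    wt len t (nb_paths G arev (head G' b) (head G' b)) * (ennreal (exp (- l0 * t)) * wt len' t (cont (arev' b)))"
proof -
  let ?W = "walks_from (head G' b)" and ?B = "next_block (head G' b) (tail G' b) b (cont b)"
    and ?C = "next_block (head G' b) (head G' b) (arev' b) (cont (arev' b))"
  have b': "arev' b = e \<or> arev' b = e'" "b \<noteq> arev' b" using b ee' by auto
  have new: "b \<notin> arcs G" "arev' b \<notin> arcs G" using b b' e e' by auto
  have old: "set p \<subseteq> arcs G" if "p \<in> ?W" for p using that by (simp add: walks_from_def reduced_def)
  have "?W \<inter> ?B = {}" using old new by (fastforce elim: next_blockE)
  moreover have "?W \<inter> ?C = {}" using old new by (fastforce elim: next_blockE)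
  moreover have "?B \<inter> ?C = {}"
  proof (rule equals0I, elim IntE)
    fix p assume "p \<in> ?B" "p \<in> ?C"
    then obtain q s q' s' where "p = q @ b # s" "set q \<subseteq> arcs G" "p = q' @ arev' b # s'" "set q' \<subseteq> arcs G"
      by (metis next_blockE)
    then show False using first_new_edge_unique[of q b s q' "arev' b" s'] new b'(2) by simp
  qed
  moreover have "wt len' t ?W = wt len t ?W"
    by (rule wt_cong_length) (auto intro!: path_length_attach simp: walks_from_def reduced_def)
  ultimately have "wt len' t (?W \<union> ?B \<union> ?C) =
      wt len t ?W + wt len' t ?B + wt len' t ?C"
    by (simp add: wt_Un_disjoint Int_Un_distrib2)
  then show ?thesis
    unfolding cont_decomp[OF b, symmetric] wt_next_block[OF b] wt_next_block[OF b'(1)] .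
qed

text \<open>What follows the next new edge has fewer edges than the whole continuation, so the same
  bound \<open>n\<close> serves on both sides.\<close>

lemma wt_cont_truncated:
  assumes b: "b = e \<or> b = e'"
  shows "wt len' t {p \<in> cont b. length p \<le> n} \<le> wt len t (walks_from (head G' b)) +
    wt len t (nb_paths G arev (head G' b) (tail G' b)) *
      (ennreal (exp (- l0 * t)) * wt len' t {p \<in> cont b. length p \<le> n}) +
    wt len t (nb_paths G arev (head G' b) (head G' b)) *
      (ennreal (exp (- l0 * t)) * wt len' t {p \<in> cont (arev' b). length p \<le> n})"
proof -
  let ?W = "walks_from (head G' b)"
    and ?B = "next_block (head G' b) (tail G' b) b {p \<in> cont b. length p \<le> n}"
    and ?C = "next_block (head G' b) (head G' b) (arev' b) {p \<in> cont (arev' b). length p \<le> n}"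
  have b': "arev' b = e \<or> arev' b = e'" using b ee' by auto
  have "{p \<in> cont b. length p \<le> n} \<subseteq> ?W \<union> ?B \<union> ?C"
  proof
    fix p assume "p \<in> {p \<in> cont b. length p \<le> n}"
    then show "p \<in> ?W \<union> ?B \<union> ?C"
      by (subst (asm) cont_decomp[OF b]) (auto simp: next_block_def)
  qed
  then have "wt len' t {p \<in> cont b. length p \<le> n} \<le> wt len' t (?W \<union> ?B \<union> ?C)" by (rule wt_mono)
  also have "\<dots> \<le> wt len' t (?W \<union> ?B) + wt len' t ?C" by (rule wt_Un_le)
  also have "\<dots> \<le> wt len' t ?W + wt len' t ?B + wt len' t ?C" by (intro add_right_mono wt_Un_le)
  also have "wt len' t ?W = wt len t ?W"
    by (rule wt_cong_length) (auto intro!: path_length_attach simp: walks_from_def reduced_def)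
  finally show ?thesis unfolding wt_next_block[OF b] wt_next_block[OF b'] .
qed

end

section \<open>The two-dimensional linear system\<close>

text \<open>\<open>c + sqrt (a * b)\<close> is the larger eigenvalue of the matrix with rows
  \<open>(c, b)\<close> and \<open>(a, c)\<close>. Positivity of \<open>g\<close> and
  \<open>g'\<close> makes both inequalities strict once these terms are dropped; multiplying them
  and cancelling \<open>u * v\<close> gives \<open>a * b < (1 - c)^2\<close>.\<close>

lemma spectral_bound_if_supersolution:
  fixes a b c u v g g' :: real
  assumes "0 \<le> a" "0 \<le> b" "0 \<le> u" "0 \<le> v" "0 < g" "0 < g'"
    and u: "g + c * u + b * v \<le> u" and v: "g' + c * v + a * u \<le> v"
  shows "c + sqrt (a * b) < 1"
proof -
  have u': "b * v < (1 - c) * u" and v': "a * u < (1 - c) * v"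
    using u v assms(5,6) by (auto simp: algebra_simps)
  have "0 < (1 - c) * u" using u' assms by (intro le_less_trans[OF mult_nonneg_nonneg u']) auto
  then have c: "0 < 1 - c" and "0 < u" using assms(3) by (auto simp: zero_less_mult_iff)
  have "0 < (1 - c) * v" using v' assms by (intro le_less_trans[OF mult_nonneg_nonneg v']) auto
  then have "0 < v" using c by (auto simp: zero_less_mult_iff)
  have "(a * u) * (b * v) < ((1 - c) * v) * ((1 - c) * u)"
    by (rule mult_strict_mono'[OF v' u']) (use assms in auto)
  then have "(a * b) * (u * v) < (1 - c)\<^sup>2 * (u * v)" by (simp add: power2_eq_square ac_simps)
  then have "a * b < (1 - c)\<^sup>2" using \<open>0 < u\<close> \<open>0 < v\<close> by simp
  then have "sqrt (a * b) < 1 - c" using c by (intro real_less_lsqrt) auto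
  then show ?thesis by simp
qed

text \<open>The bound is the solution of the system by Cramer's rule: the first inequality times
  \<open>1 - c\<close> plus the second times \<open>b\<close> eliminates \<open>v\<close>, and
  smallness of the eigenvalue makes the determinant positive.\<close>

lemma subsolution_bound:
  fixes a b c u v g g' :: real
  assumes "0 \<le> a" "0 \<le> b" and small: "c + sqrt (a * b) < 1"
    and u: "u \<le> g + c * u + b * v" and v: "v \<le> g' + c * v + a * u"
  shows "u \<le> ((1 - c) * g + b * g') / ((1 - c)\<^sup>2 - a * b)"
proof -
  have s: "0 \<le> sqrt (a * b)" using assms by simp
  have c: "0 < 1 - c" using small s by linarith
  have "(sqrt (a * b))\<^sup>2 < (1 - c)\<^sup>2" using small s by (intro power_strict_mono) auto
  then have D: "0 < (1 - c)\<^sup>2 - a * b" using assms by simp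
  have "(1 - c) * ((1 - c) * u) \<le> (1 - c) * (g + b * v)"
    using u c by (intro mult_left_mono) (auto simp: algebra_simps)
  moreover have "b * ((1 - c) * v) \<le> b * (g' + a * u)"
    using v assms by (intro mult_left_mono) (auto simp: algebra_simps)
  ultimately have "u * ((1 - c)\<^sup>2 - a * b) \<le> (1 - c) * g + b * g'"
    by (simp add: algebra_simps power2_eq_square)
  then show ?thesis using D by (simp add: pos_le_divide_eq)
qed

section \<open>Convergence for the extended graph in terms of the generating functions\<close>

context attached_edge
begin

abbreviation (input) "Wt t z w \<equiv> wt len t (nb_paths G arev z w)"

text \<open>A finite total weight makes the weights of the continuations a finite positive solution
  of the linear system, whose coefficients are the generating functions scaled by
  \<open>exp (- l0 * t)\<close>.\<close>

lemma wt_reduced_attach_finiteD: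
  assumes "wt len' t (Collect A.reduced) < \<infinity>"
  obtains a b c where "0 \<le> a" "0 \<le> b" "0 \<le> c"
    "Wt t x x = ennreal a" "Wt t y y = ennreal b" "Wt t x y = ennreal c"
    "c + sqrt (a * b) < exp (l0 * t)"
proof -
  let ?E = "exp (- l0 * t)"
  have fin: "wt len' t (cont b) < \<infinity>" for b
    by (rule le_less_trans[OF wt_mono assms]) (auto simp: cont_def A.reduced_Cons)
  obtain u where u: "wt len' t (cont e) = ennreal u" "0 \<le> u" using fin[of e] by (cases "wt len' t (cont e)") auto
  obtain v where v: "wt len' t (cont e') = ennreal v" "0 \<le> v" using fin[of e'] by (cases "wt len' t (cont e')") auto
  have eq_u: "ennreal u = wt len t (walks_from y) + Wt t y x * (ennreal ?E * ennreal u) + Wt t y y * (ennreal ?E * ennreal v)"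
    using wt_cont[of e t] u v by simp
  have eq_v: "ennreal v = wt len t (walks_from x) + Wt t x y * (ennreal ?E * ennreal v) + Wt t x x * (ennreal ?E * ennreal u)"
    using wt_cont[of e' t] u v by simp
  \<comment> \<open>The empty walk alone gives the inhomogeneous terms weight at least 1, which also
    makes \<open>u\<close> and \<open>v\<close> positive.\<close>
  have one: "1 \<le> wt len t (walks_from z)" for z
    using wt_mono[of "{[]}" "walks_from z" len t] by (simp add: walks_from_def)
  have parts: "P \<le> s" "Q \<le> s" "R \<le> s" if "s = P + Q + R" for P Q R s :: ennreal
    unfolding that by (auto intro: add_increasing add_increasing2)
  have "1 \<le> ennreal u" "1 \<le> ennreal v"
    by (rule order_trans[OF one parts(1)[OF eq_u]], rule order_trans[OF one parts(1)[OF eq_v]])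
  then have pos: "0 < u" "0 < v" by (auto simp: ennreal_ge_1)
  \<comment> \<open>A coefficient multiplied by a positive unknown stays below a finite value, so it
    is finite itself.\<close>
  have fin_factor: "q < \<infinity>" if "q * (ennreal ?E * ennreal w) \<le> ennreal w'" "0 < w" for q w w'
  proof -
    have "q * (ennreal ?E * ennreal w) < \<infinity>" using that(1) by (rule le_less_trans) simp
    then show ?thesis using that(2) by (auto simp: ennreal_mult_less_top ennreal_eq_0_iff)
  qed
  have fin_y: "Wt t x y < \<infinity>" "Wt t y y < \<infinity>"
    using fin_factor[OF parts(2)[OF eq_v] pos(2)] fin_factor[OF parts(3)[OF eq_u] pos(2)] by auto
  have fin_x: "Wt t x x < \<infinity>"
    by (rule fin_factor[OF parts(3)[OF eq_v] pos(1)])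
  obtain a where a: "Wt t x x = ennreal a" "0 \<le> a" using fin_x by (cases "Wt t x x") auto
  obtain b where b: "Wt t y y = ennreal b" "0 \<le> b" using fin_y by (cases "Wt t y y") auto
  obtain c where c: "Wt t x y = ennreal c" "0 \<le> c" using fin_y by (cases "Wt t x y") auto
  have real_le: "1 + p * (?E * u) + q * (?E * v) \<le> w"
    if "ennreal w = g + ennreal p * (ennreal ?E * ennreal u) + ennreal q * (ennreal ?E * ennreal v)"
      "1 \<le> g" "0 \<le> p" "0 \<le> q" "0 \<le> w" for p q w g
  proof -
    have "ennreal (1 + p * (?E * u) + q * (?E * v)) =
        1 + ennreal p * (ennreal ?E * ennreal u) + ennreal q * (ennreal ?E * ennreal v)"
      using that u v by (simp add: ennreal_plus ennreal_mult)
    also have "\<dots> \<le> ennreal w" unfolding that(1) using that(2) by (intro add_right_mono)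
    finally show ?thesis using that(5) by simp
  qed
  have le_u: "1 + (?E * c) * u + (?E * b) * v \<le> u"
    using real_le[OF eq_u[unfolded wt_nb_paths_commute[of t y x] b c] one] b c u
    by (simp add: ac_simps)
  have "1 + a * (?E * u) + c * (?E * v) \<le> v"
    by (rule real_le[OF _ one, of _ x]) (use eq_v a c v in \<open>simp_all add: ac_simps\<close>)
  then have le_v: "1 + (?E * c) * v + (?E * a) * u \<le> v" by (simp add: ac_simps)
  have "?E * c + sqrt ((?E * a) * (?E * b)) < 1"
    by (rule spectral_bound_if_supersolution[OF _ _ u(2) v(2) _ _ le_u le_v]) (use a b in auto)
  also have "sqrt ((?E * a) * (?E * b)) = ?E * sqrt (a * b)"
    by (simp add: real_sqrt_mult)
  finally have "c + sqrt (a * b) < exp (l0 * t)" by (simp add: exp_minus field_simps)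
  then show thesis using a b c that by blast
qed

text \<open>The truncated continuations have finite weights that form a subsolution, so
  \<open>subsolution_bound\<close> bounds them uniformly in \<open>n\<close>, and hence the full
  weights.\<close>

lemma wt_walks_from_attach_finiteI:
  assumes "0 \<le> a" "0 \<le> b" "0 \<le> c" "Wt t x x = ennreal a" "Wt t y y = ennreal b" "Wt t x y = ennreal c"
    and small: "c + sqrt (a * b) < exp (l0 * t)"
  shows "wt len' t (A.walks_from y) < \<infinity>"
proof -
  let ?E = "exp (- l0 * t)"
  have "wt len t (walks_from x) < \<infinity>" "wt len t (walks_from y) < \<infinity>"
    using wt_walks_from_finite_if_closed x y assms(4,5) by auto
  then obtain g g' where g: "wt len t (walks_from y) = ennreal g" "0 \<le> g"
      and g': "wt len t (walks_from x) = ennreal g'" "0 \<le> g'"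
    by (cases "wt len t (walks_from x)"; cases "wt len t (walks_from y)") auto
  let ?a = "?E * a" and ?b = "?E * b" and ?c = "?E * c"
  have nonneg: "0 \<le> ?a" "0 \<le> ?b" "0 \<le> ?c" using assms by auto
  have "?c + sqrt (?a * ?b) = ?E * (c + sqrt (a * b))"
    by (simp add: real_sqrt_mult distrib_left)
  also have "\<dots> < ?E * exp (l0 * t)" using small by simp
  also have "\<dots> = 1" by (simp add: exp_minus)
  finally have small': "?c + sqrt (?a * ?b) < 1" .
  then have small'': "?c + sqrt (?b * ?a) < 1" by (simp add: mult.commute)
  define U where "U = ((1 - ?c) * g + ?b * g') / ((1 - ?c)\<^sup>2 - ?a * ?b)"
  define V where "V = ((1 - ?c) * g' + ?a * g) / ((1 - ?c)\<^sup>2 - ?b * ?a)"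
  have bound: "wt len' t {p \<in> cont e. length p \<le> n} \<le> ennreal U"
    "wt len' t {p \<in> cont e'. length p \<le> n} \<le> ennreal V" for n
  proof -
    have fin: "wt len' t {p \<in> cont b. length p \<le> n} < \<infinity>" for b
      by (intro wt_finite finite_subset[OF _ A.finite_reduced_length_le[of n]])
         (auto simp: cont_def A.reduced_Cons)
    obtain u where u: "wt len' t {p \<in> cont e. length p \<le> n} = ennreal u" "0 \<le> u"
      using fin[of e] by (cases "wt len' t {p \<in> cont e. length p \<le> n}") auto
    obtain v where v: "wt len' t {p \<in> cont e'. length p \<le> n} = ennreal v" "0 \<le> v"
      using fin[of e'] by (cases "wt len' t {p \<in> cont e'. length p \<le> n}") auto
    have "ennreal u \<le> ennreal (g + c * (?E * u) + b * (?E * v))"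
      using wt_cont_truncated[of e t n] u v g assms(1-6) wt_nb_paths_commute[of t y x]
      by (simp add: ennreal_plus ennreal_mult)
    then have "u \<le> g + c * (?E * u) + b * (?E * v)"
      using g u v assms(1-3) by (subst (asm) ennreal_le_iff) auto
    then have 1: "u \<le> g + ?c * u + ?b * v" by (simp add: ac_simps)
    have "ennreal v \<le> ennreal (g' + c * (?E * v) + a * (?E * u))"
      using wt_cont_truncated[of e' t n] u v g' assms(1-6)
      by (simp add: ennreal_plus ennreal_mult)
    then have "v \<le> g' + c * (?E * v) + a * (?E * u)"
      using g' u v assms(1-3) by (subst (asm) ennreal_le_iff) auto
    then have 2: "v \<le> g' + ?c * v + ?a * u" by (simp add: ac_simps)
    show "wt len' t {p \<in> cont e. length p \<le> n} \<le> ennreal U"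
      unfolding u U_def by (intro ennreal_leI subsolution_bound[OF nonneg(1,2) small' 1 2])
    show "wt len' t {p \<in> cont e'. length p \<le> n} \<le> ennreal V"
      unfolding v V_def by (intro ennreal_leI subsolution_bound[OF nonneg(2,1) small'' 2 1])
  qed
  have lim: "wt len' t (cont b) < \<infinity>" if "\<And>n. wt len' t {p \<in> cont b. length p \<le> n} \<le> ennreal B" for b B
  proof -
    have "wt len' t (cont b) \<le> ennreal (max 0 B)"
    proof (rule wt_le_if_finite_subsets)
      fix S assume S: "finite S" "S \<subseteq> cont b"
      then have "S \<subseteq> {p \<in> cont b. length p \<le> Max (insert 0 (length ` S))}" by auto
      then have "wt len' t S \<le> wt len' t {p \<in> cont b. length p \<le> Max (insert 0 (length ` S))}" by (rule wt_mono)
      also have "\<dots> \<le> ennreal B" by (rule that)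
      also have "\<dots> \<le> ennreal (max 0 B)" by (intro ennreal_leI) simp
      finally show "wt len' t S \<le> ennreal (max 0 B)" .
    qed simp
    then show ?thesis by (rule le_less_trans) simp
  qed
  have fin_e: "wt len' t (cont e) < \<infinity>" by (rule lim) (rule bound)
  have fin_e': "wt len' t (cont e') < \<infinity>" by (rule lim) (rule bound)
  \<comment> \<open>A walk from \<open>y\<close> continues \<open>e\<close>, which ends at
    \<open>y\<close>, unless it starts with the reverse \<open>e'\<close>; then its remainder
    continues \<open>e'\<close>.\<close>
  have "A.walks_from y \<subseteq> cont e \<union> (#) e' ` cont e'"
  proof
    fix p assume p: "p \<in> A.walks_from y"
    show "p \<in> cont e \<union> (#) e' ` cont e'"
    proof (cases "p \<noteq> [] \<and> hd p = e'")
      case True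
      then obtain q where "p = e' # q" by (cases p) auto
      then show ?thesis using p by (auto simp: cont_def A.walks_from_def)
    next
      case False
      then have "A.reduced (e # p)" using p by (auto simp: A.walks_from_def A.reduced_Cons)
      then show ?thesis by (simp add: cont_def)
    qed
  qed
  then have "wt len' t (A.walks_from y) \<le> wt len' t (cont e \<union> (#) e' ` cont e')" by (rule wt_mono)
  also have "\<dots> \<le> wt len' t (cont e) + wt len' t ((#) e' ` cont e')" by (rule wt_Un_le)
  also have "\<dots> < \<infinity>" using fin_e fin_e' by (simp add: wt_Cons_image ennreal_mult_less_top)
  finally show ?thesis .
qed

end

section \<open>Passage to the critical exponent\<close>

lemma mult_infsum_le:
  fixes f :: "'c \<Rightarrow> real"
  assumes "f summable_on A" and "\<And>S. finite S \<Longrightarrow> S \<subseteq> A \<Longrightarrow> k * sum f S \<le> C"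
  shows "k * infsum f A \<le> C"
proof -
  have "(\<Sum>\<^sub>\<infinity>i\<in>A. k * f i) \<le> C"
    by (rule infsum_le_finite_sums)
       (use assms in \<open>auto intro: summable_on_cmult_right simp: sum_distrib_left[symmetric]\<close>)
  then show ?thesis using assms(1) by (simp add: infsum_cmult_right)
qed

context attached_edge
begin

lemma wt_nonempty_ge_1: "p \<in> A \<Longrightarrow> 1 \<le> wt len 0 A"
  using wt_mono[of "{p}" A len 0] by simp

text \<open>At exponent 0 every walk weighs 1, so the nonemptiness condition gives
  \<open>c >= 1\<close> or \<open>a, b >= 1\<close>, against
  \<open>c + sqrt (a * b) < 1\<close>.\<close>

lemma wt_reduced_attach_0:
  assumes "nb_paths G arev x y \<noteq> {} \<or> (nb_paths G arev x x \<noteq> {} \<and> nb_paths G arev y y \<noteq> {})"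
  shows "wt len' 0 (Collect A.reduced) = \<infinity>"
proof (rule ccontr)
  assume "wt len' 0 (Collect A.reduced) \<noteq> \<infinity>"
  then have "wt len' 0 (Collect A.reduced) < \<infinity>" by (simp add: less_top)
  then obtain a b c where abc: "0 \<le> a" "0 \<le> b" "0 \<le> c"
      "wt len 0 (nb_paths G arev x x) = ennreal a" "wt len 0 (nb_paths G arev y y) = ennreal b"
      "wt len 0 (nb_paths G arev x y) = ennreal c" "c + sqrt (a * b) < exp (l0 * 0)"
    by (rule wt_reduced_attach_finiteD)
  have small: "c + sqrt (a * b) < 1" using abc(7) by simp
  from assms show False
  proof
    assume "nb_paths G arev x y \<noteq> {}"
    then have "1 \<le> c" using wt_nonempty_ge_1 abc(6) by (metis ennreal_ge_1 equals0I)
    moreover have "0 \<le> sqrt (a * b)" using abc by simp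
    ultimately show False using small by linarith
  next
    assume "nb_paths G arev x x \<noteq> {} \<and> nb_paths G arev y y \<noteq> {}"
    then have "1 \<le> a" "1 \<le> b" using wt_nonempty_ge_1 abc(4,5) by (metis ennreal_ge_1 equals0I)+
    then have "1 \<le> sqrt (a * b)" using mult_mono[of 1 a 1 b] by simp
    then show False using abc(3) small by linarith
  qed
qed

abbreviation "\<sigma> S t \<equiv> (\<Sum>p\<in>S. exp (- path_length len p * t))"

lemma finite_sums_le_above:
  assumes "wt len' t (Collect A.reduced) < \<infinity>"
    and S: "finite S1" "S1 \<subseteq> nb_paths G arev x x" "finite S2" "S2 \<subseteq> nb_paths G arev y y"
      "finite S3" "S3 \<subseteq> nb_paths G arev x y"
  shows "\<sigma> S3 t + sqrt (\<sigma> S1 t * \<sigma> S2 t) \<le> exp (l0 * t)"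
proof -
  obtain a b c where abc: "0 \<le> a" "0 \<le> b" "0 \<le> c"
      "wt len t (nb_paths G arev x x) = ennreal a" "wt len t (nb_paths G arev y y) = ennreal b"
      "wt len t (nb_paths G arev x y) = ennreal c" "c + sqrt (a * b) < exp (l0 * t)"
    using assms(1) by (rule wt_reduced_attach_finiteD)
  have le: "\<sigma> S t \<le> w" if "finite S" "S \<subseteq> P" "wt len t P = ennreal w" "0 \<le> w" for S P w
    using wt_mono[OF that(2), of len t] that by (simp add: wt_finite_sum)
  have "\<sigma> S3 t \<le> c" "\<sigma> S1 t \<le> a" "\<sigma> S2 t \<le> b" using le S abc by blast+
  moreover have "0 \<le> \<sigma> S1 t" "0 \<le> \<sigma> S2 t" by (simp_all add: sum_nonneg)
  ultimately have "\<sigma> S3 t + sqrt (\<sigma> S1 t * \<sigma> S2 t) \<le> c + sqrt (a * b)"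
    by (intro add_mono real_sqrt_le_mono mult_mono) (use abc in auto)
  then show ?thesis using abc(7) by simp
qed

text \<open>Convergence of the generating functions at \<open>h\<close> is not yet known, so the
  limit from the right is taken in finite partial sums, which are continuous in
  \<open>t\<close>.\<close>

lemma finite_sums_le:
  assumes "\<And>t. h < t \<Longrightarrow> wt len' t (Collect A.reduced) < \<infinity>"
    and S: "finite S1" "S1 \<subseteq> nb_paths G arev x x" "finite S2" "S2 \<subseteq> nb_paths G arev y y"
      "finite S3" "S3 \<subseteq> nb_paths G arev x y"
  shows "\<sigma> S3 h + sqrt (\<sigma> S1 h * \<sigma> S2 h) \<le> exp (l0 * h)"
proof (rule tendsto_le)
  show "((\<lambda>t. exp (l0 * t)) \<longlongrightarrow> exp (l0 * h)) (at_right h)"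
    "((\<lambda>t. \<sigma> S3 t + sqrt (\<sigma> S1 t * \<sigma> S2 t)) \<longlongrightarrow> \<sigma> S3 h + sqrt (\<sigma> S1 h * \<sigma> S2 h)) (at_right h)"
    by (intro tendsto_intros)+
  show "\<forall>\<^sub>F t in at_right h. \<sigma> S3 t + sqrt (\<sigma> S1 t * \<sigma> S2 t) \<le> exp (l0 * t)"
    using eventually_at_right_less[of h]
    by eventually_elim (intro finite_sums_le_above assms)
qed simp

lemma gen_fun_equation:
  assumes conn: "\<And>w. w \<in> verts G' \<Longrightarrow> y \<rightarrow>\<^sup>*\<^bsub>G'\<^esub> w"
    and nondeg: "nb_paths G arev x y \<noteq> {} \<or> (nb_paths G arev x x \<noteq> {} \<and> nb_paths G arev y y \<noteq> {})"
    and h: "wt len' h (Collect A.reduced) = \<infinity>"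
    and above: "\<And>t. h < t \<Longrightarrow> wt len' t (Collect A.reduced) < \<infinity>"
  shows "gen_fun_converges G arev len x x h \<and> gen_fun_converges G arev len y y h \<and>
    gen_fun_converges G arev len x y h \<and>
    exp (l0 * h) = sqrt (gen_fun G arev len x x h * gen_fun G arev len y y h) + gen_fun G arev len x y h"
proof -
  let ?X = "nb_paths G arev x x" and ?Y = "nb_paths G arev y y" and ?C = "nb_paths G arev x y"
  let ?f = "\<lambda>p. exp (- path_length len p * h)"
  let ?E = "exp (l0 * h)"
  have le: "\<sigma> S3 h + sqrt (\<sigma> S1 h * \<sigma> S2 h) \<le> ?E"
    if "finite S1" "S1 \<subseteq> ?X" "finite S2" "S2 \<subseteq> ?Y" "finite S3" "S3 \<subseteq> ?C" for S1 S2 S3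
    using above that by (rule finite_sums_le)
  have fin: "wt len h ?X < \<infinity> \<and> wt len h ?Y < \<infinity> \<and> wt len h ?C < \<infinity>"
  proof (cases "?C = {}")
    case False
    \<comment> \<open>With the other two sums empty, the inequality bounds the paths from
      \<open>x\<close> to \<open>y\<close>; closed paths follow by change of end point.\<close>
    have "wt len h ?C \<le> ennreal ?E"
      by (rule wt_le_if_finite_subsets) (use le[of "{}" "{}"] in \<open>auto simp: wt_finite_sum intro!: ennreal_leI\<close>)
    then have "wt len h ?C < \<infinity>" by (rule le_less_trans) simp
    then show ?thesis using wt_closed_finite_if_connecting[OF False] by blast
  next
    case True
    then obtain p q where p: "p \<in> ?X" and q: "q \<in> ?Y" using nondeg by blast
    \<comment> \<open>Without paths from \<open>x\<close> to \<open>y\<close>, one fixed closed path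
      at one vertex, of weight \<open>w\<close>, bounds the sums at the other.\<close>
    have bound: "\<sigma> S h \<le> ?E\<^sup>2 / w" if "sqrt (\<sigma> S h * w) \<le> ?E" "0 < w" for S w
    proof -
      have "\<sigma> S h * w \<le> ?E\<^sup>2" using that(1) by (rule sqrt_le_D)
      then show ?thesis using that(2) by (simp add: pos_le_divide_eq)
    qed
    have "wt len h ?X \<le> ennreal (?E\<^sup>2 / ?f q)"
    proof (rule wt_le_if_finite_subsets)
      fix S assume "finite S" "S \<subseteq> ?X"
      then have "sqrt (\<sigma> S h * ?f q) \<le> ?E" using le[of S "{q}" "{}"] q by simp
      then show "wt len h S \<le> ennreal (?E\<^sup>2 / ?f q)"
        using \<open>finite S\<close> bound[of S "?f q"] by (simp only: wt_finite_sum) (intro ennreal_leI, simp)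
    qed simp
    then have "wt len h ?X < \<infinity>" by (rule le_less_trans) simp
    moreover have "wt len h ?Y \<le> ennreal (?E\<^sup>2 / ?f p)"
    proof (rule wt_le_if_finite_subsets)
      fix S assume "finite S" "S \<subseteq> ?Y"
      then have "sqrt (\<sigma> S h * ?f p) \<le> ?E" using le[of "{p}" S "{}"] p by (simp add: mult.commute)
      then show "wt len h S \<le> ennreal (?E\<^sup>2 / ?f p)"
        using \<open>finite S\<close> bound[of S "?f p"] by (simp only: wt_finite_sum) (intro ennreal_leI, simp)
    qed simp
    then have "wt len h ?Y < \<infinity>" by (rule le_less_trans) simp
    ultimately show ?thesis using True by simp
  qed
  then have summable: "?f summable_on ?X" "?f summable_on ?Y" "?f summable_on ?C"
    by (simp_all only: summable_iff_wt_finite)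
  define a b c where "a = infsum ?f ?X" and "b = infsum ?f ?Y" and "c = infsum ?f ?C"
  have nonneg: "0 \<le> a" "0 \<le> b" "0 \<le> c" by (simp_all add: a_def b_def c_def infsum_nonneg)
  have wt: "wt len h ?X = ennreal a" "wt len h ?Y = ennreal b" "wt len h ?C = ennreal c"
    unfolding a_def b_def c_def by (rule wt_eq_infsum, use fin in blast)+
  \<comment> \<open>The three finite sets are replaced by the full sets one at a time: first
    \<open>S3\<close>, then \<open>S2\<close>, then \<open>S1\<close>.\<close>
  have c_le: "c \<le> ?E - sqrt (\<sigma> S1 h * \<sigma> S2 h)"
    if "finite S1" "S1 \<subseteq> ?X" "finite S2" "S2 \<subseteq> ?Y" for S1 S2
    unfolding c_def using le[OF that] by (intro infsum_le_finite_sums[OF summable(3)]) (simp add: le_diff_eq)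
  have "\<sigma> S1 h * \<sigma> S2 h \<le> (?E - c)\<^sup>2" if "finite S1" "S1 \<subseteq> ?X" "finite S2" "S2 \<subseteq> ?Y" for S1 S2
    by (rule sqrt_le_D) (use c_le[OF that] in simp)
  then have "\<sigma> S1 h * b \<le> (?E - c)\<^sup>2" if "finite S1" "S1 \<subseteq> ?X" for S1
    unfolding b_def using that by (intro mult_infsum_le[OF summable(2)]) auto
  then have "b * a \<le> (?E - c)\<^sup>2"
    unfolding a_def by (intro mult_infsum_le[OF summable(1)]) (simp add: mult.commute)
  then have "sqrt (a * b) \<le> ?E - c"
    using c_le[of "{}" "{}"] by (intro real_le_lsqrt) (simp_all add: mult.commute)
  \<comment> \<open>A strict inequality would make the series converge at \<open>h\<close>.\<close>
  moreover have "\<not> c + sqrt (a * b) < ?E"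
  proof
    assume "c + sqrt (a * b) < ?E"
    then have "wt len' h (A.walks_from y) < \<infinity>"
      using wt_walks_from_attach_finiteI nonneg wt by blast
    then have "wt len' h (Collect A.reduced) < \<infinity>"
      by (rule A.wt_reduced_finite_if_walks_from[rotated 2]) (use y conn in auto)
    then show False using h by simp
  qed
  ultimately have "?E = sqrt (a * b) + c" by linarith
  then show ?thesis
    unfolding gen_fun_converges_def gen_fun_def using summable by (simp only: a_def b_def c_def)
qed

theorem volume_entropy_attach_edge:
  assumes conn: "Digraph_Component.connected G'"
    and nondeg: "nb_paths G arev x y \<noteq> {} \<or> (nb_paths G arev x x \<noteq> {} \<and> nb_paths G arev y y \<noteq> {})"
    and h: "h = volume_entropy G' arev' len'"
  shows "gen_fun_converges G arev len x x h \<and> gen_fun_converges G arev len y y h \<and>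
    gen_fun_converges G arev len x y h \<and>
    exp (l0 * h) = sqrt (gen_fun G arev len x x h * gen_fun G arev len y y h) + gen_fun G arev len x y h"
proof -
  \<comment> \<open>Every edge has a reverse, so connectedness already provides directed walks
    between any two vertices.\<close>
  have "strongly_connected G'"
    by (rule A.symmetric_connected_imp_strongly_connected[OF A.sym_arcs conn])
  then have conn': "z \<rightarrow>\<^sup>*\<^bsub>G'\<^esub> w" if "z \<in> verts G'" "w \<in> verts G'" for z w
    using that by (simp add: strongly_connected_def)
  have y': "y \<in> verts G'" using y by simp
  obtain k where k: "0 \<le> k" "wt len' k (Collect A.reduced) = \<infinity>"
      "\<And>t. k < t \<Longrightarrow> wt len' t (Collect A.reduced) < \<infinity>"
    by (rule A.critical_exponent_exists[OF wt_reduced_attach_0[OF nondeg]]) (rule that)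
  have "h = k" unfolding h by (rule A.volume_entropy_eqI) (use conn' y' k in auto)
  then show ?thesis using gen_fun_equation[OF conn'[OF y'] nondeg k(2,3)] by simp
qed

end

text \<open>The nonemptiness condition rules out cases such as two isolated vertices joined by
  \<open>e\<close>: there the extended graph is a tree of entropy 0, whereas all three generating
  functions vanish.\<close>

theorem theorem1p1:
  fixes G G' :: "('a, 'b) pre_digraph"
    and arev arev' :: "'b \<Rightarrow> 'b" and len len' :: "'b \<Rightarrow> real"
    and x y :: 'a and e e' :: 'b and l0 h :: real
  assumes "fin_metric_graph G arev len"
    and "x \<in> verts G" and "y \<in> verts G" and "x \<noteq> y"
    and "\<not> x \<rightarrow>\<^bsub>G\<^esub> y"
    and "e \<notin> arcs G" and "e' \<notin> arcs G" and "e \<noteq> e'" and "0 < l0"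
    and "G' = attach_edge G x y e e'"
    and "arev' = arev(e := e', e' := e)"
    and "len' = len(e := l0, e' := l0)"
    and "Digraph_Component.connected G'"
    and "nb_paths G arev x y \<noteq> {} \<or> (nb_paths G arev x x \<noteq> {} \<and> nb_paths G arev y y \<noteq> {})"
    and "h = volume_entropy G' arev' len'"
  shows "gen_fun_converges G arev len x x h \<and>
         gen_fun_converges G arev len y y h \<and>
         gen_fun_converges G arev len x y h \<and>
         exp (l0 * h) =
           sqrt (gen_fun G arev len x x h * gen_fun G arev len y y h) + gen_fun G arev len x y h"
proof -
  have loc: "attached_edge G arev len x y e e' l0"
    using assms by (simp add: attached_edge_def attached_edge_axioms_def)
  show ?thesis
    by (rule attached_edge.volume_entropy_attach_edge[OF loc])
      (use assms in \<open>simp_all add: attached_edge.G'_def[OF loc] attached_edge.arev'_def[OF loc]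
        attached_edge.len'_def[OF loc]\<close>)
qed

end
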